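(* Let $p$ be an odd prime and let $x$ be a $p$-adic integer. Let $a$ be a positive integer, $b,c\in\mathbb{Z}$ and $d=b^2-4c$. Set $D:=1+2bx+dx^2$. Then $$\sum_{k=0}^{p^a-1}\frac{\binom{2k}{k}^2}{(-16)^k}T_k(b,c)x^k\equiv\left(\sum_{k=0}^{p^a-1}\frac{\binom{2k}{k}^2}{32^k}(1-\sqrt{D}+\sqrt{d}\,x)^k\right)\left(\sum_{k=0}^{p^a-1}\frac{\binom{2k}{k}^2}{32^k}(1-\sqrt{D}-\sqrt{d}\,x)^k\right)$$ $$\equiv P_{(p^a-1)/2}(\sqrt{D}+\sqrt{d}\,x)\,P_{(p^a-1)/2}(\sqrt{D}-\sqrt{d}\,x)\pmod{p^2}$$ and $$\sum_{k=0}^{p^a-1}\frac{\binom{4k}{2k}\binom{2k}{k}}{(-64)^k}T_k(b,c)x^k\equiv\left(\sum_{k=0}^{p^a-1}\frac{\binom{4k}{2k}\binom{2k}{k}}{128^k}(1-\sqrt{D}+\sqrt{d}\,x)^k\right)\left(\sum_{k=0}^{p^a-1}\frac{\binom{4k}{2k}\binom{2k}{k}}{128^k}(1-\sqrt{D}-\sqrt{d}\,x)^k\right)\pmod{p^2}.$$ If $p>3$, then $$\sum_{k=0}^{p^a-1}\frac{\binom{2k}{k}\binom{3k}{k}}{(-27)^k}T_k(b,c)x^k\equiv\left(\sum_{k=0}^{p^a-1}\frac{\binom{2k}{k}\binom{3k}{k}}{54^k}(1-\sqrt{D}+\sqrt{d}\,x)^k\right)\left(\sum_{k=0}^{p^a-1}\frac{\binom{2k}{k}\binom{3k}{k}}{54^k}(1-\sqrt{D}-\sqrt{d}\,x)^k\right)\pmod{p^2}$$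 and $$\sum_{k=0}^{p^a-1}\frac{\binom{6k}{3k}\binom{3k}{k}}{(-432)^k}T_k(b,c)x^k\equiv\left(\sum_{k=0}^{p^a-1}\frac{\binom{6k}{3k}\binom{3k}{k}}{864^k}(1-\sqrt{D}+\sqrt{d}\,x)^k\right)\left(\sum_{k=0}^{p^a-1}\frac{\binom{6k}{3k}\binom{3k}{k}}{864^k}(1-\sqrt{D}-\sqrt{d}\,x)^k\right)\pmod{p^2}.$$
   Context: For integers $b,c$ and $n\ge 0$, $T_n(b,c)=[t^n](t^2+bt+c)^n=\sum_{k=0}^{\lfloor n/2\rfloor}\binom{n}{2k}\binom{2k}{k}b^{n-2k}c^k$ (with $0^0=1$). $P_n$ is the Legendre polynomial $P_n(t)=\sum_{k=0}^n\binom nk\binom{n+k}k\left(\frac{t-1}2\right)^k$. Here $\sqrt d$ and $\sqrt D$ are viewed as algebraic $p$-adic integers: fix any square roots of $d$ and $D$ in an algebraic closure $\overline{\mathbb{Q}_p}$; they are integral over $\mathbb{Z}_p$. Congruence modulo $p^2$ means that the difference lies in $p^2\mathcal{O}$, where $\mathcal{O}$ is the integral closure of $\mathbb{Z}_p$ in $\overline{\mathbb{Q}_p}$. *)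

theory Defs
  imports
    "HOL-Algebra.Algebraic_Closure_Type"
    "HOL-Computational_Algebra.Computational_Algebra"
    "Berlekamp_Zassenhaus.Finite_Field"
begin

section \<open>The p-adic integers\<close>

text \<open>
  The prime \<open>p\<close> is carried by a type \<open>'p\<close> of prime cardinality. A p-adic integer is an element of
  the inverse limit of the rings of integers modulo \<open>p ^ n\<close>, given by its sequence of least
  nonnegative residues.
\<close>

typedef (overloaded) 'p::prime_card padic_int =
  "{f :: nat \<Rightarrow> int. \<forall>n. f n \<in> {0..<int CARD('p) ^ n} \<and> f (Suc n) mod int CARD('p) ^ n = f n}"
  by (rule exI[of _ "\<lambda>_. 0"]) (simp add: prime_card prime_gt_0_nat)

setup_lifting type_definition_padic_int

lemma CARD_pos [simp]: "CARD('p::prime_card) > 0"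
  by (simp add: prime_card prime_gt_0_nat)

lemma padic_residue_wf:
  fixes u v :: int
  assumes "u mod int CARD('p::prime_card) ^ n = v mod int CARD('p) ^ n"
  shows "v mod int CARD('p) ^ n \<in> {0..<int CARD('p) ^ n} \<and>
    u mod int CARD('p) ^ Suc n mod int CARD('p) ^ n = v mod int CARD('p) ^ n"
  using assms by (simp add: mod_mod_cancel)

instantiation padic_int :: (prime_card) comm_ring_1
begin

lift_definition zero_padic_int :: "'a padic_int" is "\<lambda>n. 0" by simp

lift_definition one_padic_int :: "'a padic_int" is "\<lambda>n. 1 mod int CARD('a) ^ n"
  by (rule padic_residue_wf) simp

lift_definition plus_padic_int :: "'a padic_int \<Rightarrow> 'a padic_int \<Rightarrow> 'a padic_int"
  is "\<lambda>f g n. (f n + g n) mod int CARD('a) ^ n"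
  by (rule padic_residue_wf) (metis mod_add_eq mod_mod_trivial)

lift_definition minus_padic_int :: "'a padic_int \<Rightarrow> 'a padic_int \<Rightarrow> 'a padic_int"
  is "\<lambda>f g n. (f n - g n) mod int CARD('a) ^ n"
  by (rule padic_residue_wf) (metis mod_diff_eq mod_mod_trivial)

lift_definition uminus_padic_int :: "'a padic_int \<Rightarrow> 'a padic_int"
  is "\<lambda>f n. (- f n) mod int CARD('a) ^ n"
  by (rule padic_residue_wf) (metis mod_minus_eq mod_mod_trivial)

lift_definition times_padic_int :: "'a padic_int \<Rightarrow> 'a padic_int \<Rightarrow> 'a padic_int"
  is "\<lambda>f g n. (f n * g n) mod int CARD('a) ^ n"
  by (rule padic_residue_wf) (metis mod_mult_eq mod_mod_trivial)

instance
proof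
  fix a b c :: "'a padic_int"
  show "a * b * c = a * (b * c)"
    by transfer (simp add: mod_mult_left_eq mod_mult_right_eq mult.assoc)
  show "a * b = b * a"
    by transfer (simp add: mult.commute)
  show "1 * a = a"
    by transfer (simp add: mod_mult_left_eq fun_eq_iff)
  show "a + b + c = a + (b + c)"
    by transfer (simp add: mod_add_left_eq mod_add_right_eq add.assoc)
  show "a + b = b + a"
    by transfer (simp add: add.commute)
  show "0 + a = a"
    by transfer (simp add: fun_eq_iff)
  show "- a + a = 0"
    by transfer (simp add: fun_eq_iff mod_add_left_eq)
  show "a - b = a + - b"
    by transfer (simp add: fun_eq_iff mod_add_right_eq)
  show "(a + b) * c = a * c + b * c"
    by transfer (simp add: fun_eq_iff mod_add_eq mod_mult_left_eq distrib_right)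
  show "(0 :: 'a padic_int) \<noteq> 1"
  proof transfer
    have "(1::int) mod int CARD('a) ^ 1 = 1"
      using prime_gt_1_nat[OF prime_card[where 'a = 'a]] by simp
    thus "(\<lambda>n::nat. 0::int) \<noteq> (\<lambda>n. 1 mod int CARD('a) ^ n)"
      by (metis zero_neq_one)
  qed
qed

end

lemma padic_residue_mod:
  fixes f :: "nat \<Rightarrow> int"
  assumes "\<forall>n. f n \<in> {0..<q ^ n} \<and> f (Suc n) mod q ^ n = f n"
  shows "f (n + m) mod q ^ n = f n"
proof (induction m)
  case 0
  show ?case using assms by simp
next
  case (Suc m)
  have "f (n + Suc m) mod q ^ n = f (Suc (n + m)) mod q ^ (n + m) mod q ^ n"
    by (simp add: mod_mod_cancel le_imp_power_dvd)
  also have "\<dots> = f n" using assms Suc.IH by simp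
  finally show ?case .
qed

instance padic_int :: (prime_card) idom
proof
  fix a b :: "'a padic_int"
  assume "a \<noteq> 0" "b \<noteq> 0"
  thus "a * b \<noteq> 0"
  proof transfer
    fix f g :: "nat \<Rightarrow> int"
    let ?q = "int CARD('a)"
    assume f: "\<forall>n. f n \<in> {0..<?q ^ n} \<and> f (Suc n) mod ?q ^ n = f n" and f0: "f \<noteq> (\<lambda>n. 0)"
       and g: "\<forall>n. g n \<in> {0..<?q ^ n} \<and> g (Suc n) mod ?q ^ n = g n" and g0: "g \<noteq> (\<lambda>n. 0)"
    obtain m n where mn: "f m \<noteq> 0" "g n \<noteq> 0" using f0 g0 by (meson ext)
    have q: "prime ?q" by (simp add: prime_card)
    have nf: "\<not> ?q ^ m dvd f (m + n)"
      using padic_residue_mod[OF f, of m n] mn by (simp add: dvd_eq_mod_eq_0)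
    have ng: "\<not> ?q ^ n dvd g (m + n)"
      using padic_residue_mod[OF g, of n m] mn by (simp add: dvd_eq_mod_eq_0 add.commute)
    have nz: "f (m + n) \<noteq> 0" "g (m + n) \<noteq> 0" using nf ng by auto
    have "\<not> is_unit ?q" using q not_prime_unit by blast
    hence dvd_iff: "?q ^ k dvd y \<longleftrightarrow> k \<le> multiplicity ?q y" if "y \<noteq> 0" for k y
      using that by (simp add: power_dvd_iff_le_multiplicity)
    have "multiplicity ?q (f (m + n) * g (m + n)) =
        multiplicity ?q (f (m + n)) + multiplicity ?q (g (m + n))"
      using nz q by (intro prime_elem_multiplicity_mult_distrib) auto
    also have "\<dots> < m + n"
      using nf ng dvd_iff[OF nz(1)] dvd_iff[OF nz(2)] by (meson add_strict_mono not_le)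
    finally have "\<not> ?q ^ (m + n) dvd f (m + n) * g (m + n)"
      using nz dvd_iff by (meson no_zero_divisors not_le)
    hence "(f (m + n) * g (m + n)) mod ?q ^ (m + n) \<noteq> 0"
      by (simp add: dvd_eq_mod_eq_0)
    thus "(\<lambda>n. (f n * g n) mod ?q ^ n) \<noteq> (\<lambda>n. 0)" by metis
  qed
qed

lemma Rep_padic_int_of_nat:
  "Rep_padic_int (of_nat k :: 'p::prime_card padic_int) n = int k mod int CARD('p) ^ n"
  by (induction k)
     (simp_all add: zero_padic_int.rep_eq plus_padic_int.rep_eq one_padic_int.rep_eq mod_add_eq)

instance padic_int :: (prime_card) ring_char_0
proof
  show "inj (of_nat :: nat \<Rightarrow> 'a padic_int)"
  proof (rule injI)
    fix k l :: nat
    assume eq: "(of_nat k :: 'a padic_int) = of_nat l"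
    define n where "n = max k l"
    have "n < CARD('a) ^ n"
      using prime_gt_1_nat[OF prime_card[where 'a = 'a]] by (intro power_gt_expt) simp
    hence "k < CARD('a) ^ n" "l < CARD('a) ^ n" by (simp_all add: n_def)
    moreover from eq have "int k mod int CARD('a) ^ n = int l mod int CARD('a) ^ n"
      by (metis Rep_padic_int_of_nat)
    hence "k mod CARD('a) ^ n = l mod CARD('a) ^ n"
      by (metis of_nat_eq_iff of_nat_mod of_nat_power)
    ultimately show "k = l" by simp
  qed
qed

instance fract :: ("{idom, ring_char_0}") field_char_0
proof
  show "inj (of_nat :: nat \<Rightarrow> 'a fract)"
    by (rule injI) (simp add: of_nat_fract eq_fract)
qed


section \<open>The algebraic closure of the p-adic numbers\<close>

type_synonym 'p padic = "'p padic_int fract"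

definition of_padic_int :: "'p::prime_card padic_int \<Rightarrow> 'p padic alg_closure" where
  "of_padic_int x = to_ac (to_fract x)"

definition integral_padics :: "'p::prime_card padic alg_closure set" where
  "integral_padics =
     {z. \<exists>q :: 'p padic_int poly. Polynomial.lead_coeff q = 1 \<and> poly (map_poly of_padic_int q) z = 0}"

text \<open>
  \<open>padic_cong m u v\<close> means that \<open>u\<close> and \<open>v\<close> are congruent modulo \<open>m\<close>, i.e. that \<open>u - v\<close> lies in the
  ideal generated by \<open>m\<close> in the integral closure of the p-adic integers; \<open>u\<close> and \<open>v\<close> themselves
  may be arbitrary elements of the algebraic closure.
\<close>

definition padic_cong ::
    "nat \<Rightarrow> 'p::prime_card padic alg_closure \<Rightarrow> 'p padic alg_closure \<Rightarrow> bool" where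
  "padic_cong m u v \<longleftrightarrow> (\<exists>w \<in> integral_padics. u - v = of_nat m * w)"


section \<open>Generalised central trinomial coefficients and Legendre polynomials\<close>

definition trinomial :: "nat \<Rightarrow> int \<Rightarrow> int \<Rightarrow> int" where
  "trinomial n b c = Polynomial.coeff ([:c, b, 1:] ^ n) n"

definition legendre_poly :: "nat \<Rightarrow> 'a::field_char_0 \<Rightarrow> 'a" where
  "legendre_poly n t =
     (\<Sum>k=0..n. of_nat (n choose k) * of_nat ((n + k) choose k) * ((t - 1) / 2) ^ k)"

end

theory Submission
  imports Defs
begin

text \<open>
  Put \<open>y = (1 - \<surd>D + \<surd>d x) / 2\<close> and \<open>z = (1 - \<surd>D - \<surd>d x) / 2\<close>. Then \<open>(-1)\<^sup>k T\<^sub>k(b,c) x\<^sup>k\<close> is the central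
  coefficient of \<open>((t + y(1-z)) (t + z(1-y)))\<^sup>k\<close>, which expands as the sum of
  \<open>(-1)\<^bsup>r+s+k\<^esup> C(k,r) C(k,s) C(r+s,k) y\<^sup>r z\<^sup>s\<close>. All four coefficient sequences \<open>u\<close> satisfy
  \<open>(k+1)\<^sup>2 u\<^bsub>k+1\<^esub> = (k(k+1) - c) u\<^sub>k\<close>, and every such sequence linearises its products with the same
  coefficients: \<open>u\<^sub>r u\<^sub>s\<close> is the sum of \<open>(-1)\<^bsup>r+s+k\<^esup> C(k,r) C(k,s) C(r+s,k) u\<^sub>k\<close> over all \<open>k\<close>. Hence the
  truncations differ only by terms with \<open>r, s < p\<^sup>a \<le> k \<le> r + s\<close>, and there both \<open>C(k,r)\<close> and
  \<open>C(k,s)\<close> are divisible by \<open>p\<close>. The Legendre sums agree coefficientwise modulo \<open>p\<^sup>2\<close>, because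
  \<open>p\<^sup>a / (2j+1)\<close> is divisible by \<open>p\<close> whenever \<open>2j + 1 < p\<^sup>a\<close>.
\<close>

section \<open>Linearisation of products\<close>

text \<open>The sign is that of r + s - k; the exponent is a sum because subtraction on naturals
  truncates. The coefficient vanishes unless max r s \<le> k \<le> r + s.\<close>

definition lin_coeff :: "nat \<Rightarrow> nat \<Rightarrow> nat \<Rightarrow> int" where
  "lin_coeff r s k = (-1) ^ (r + s + k) * int ((k choose r) * (k choose s) * ((r + s) choose k))"

lemma lin_coeff_eq_0: "k < r \<or> k < s \<or> r + s < k \<Longrightarrow> lin_coeff r s k = 0"
  by (auto simp: lin_coeff_def)

text \<open>Over the integers absorption holds for every k: at \<open>k = Suc n\<close> the factor
  on the left is 0, and beyond that all binomials vanish.\<close>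

lemma binomial_absorb_upper:
  "(int (Suc n) - int k) * int (Suc n choose k) = int (Suc n) * int (n choose k)"
proof (cases "k \<le> n")
  case True
  have "(Suc n - k) * (Suc n choose k) = Suc n * (n choose k)"
    using binomial_absorb_comp[of "Suc n" k] by simp
  hence "int (Suc n - k) * int (Suc n choose k) = int (Suc n) * int (n choose k)"
    by (metis of_nat_mult)
  thus ?thesis using True by (simp add: of_nat_diff)
next
  case False
  thus ?thesis by (cases "k = Suc n") (auto simp: binomial_eq_0)
qed

lemma binomial_absorb_lower:
  "int (Suc k) * int (n choose Suc k) = (int n - int k) * int (n choose k)"
proof (cases n)
  case (Suc m)
  have "int (Suc k) * int (n choose Suc k) = int n * int (m choose k)"
    unfolding Suc by (metis Suc_times_binomial of_nat_mult)
  also have "\<dots> = (int n - int k) * int (n choose k)"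
    using binomial_absorb_upper[of m k] Suc by simp
  finally show ?thesis .
qed (cases k; simp)

text \<open>This is the step in r that matches the recurrence of u in
  \<open>product_linearization\<close>. Absorption turns each of the three terms into a polynomial
  multiple of C(k,r) C(k+1,s) C(r+s,k), so that only a polynomial identity remains.\<close>

lemma lin_coeff_rec:
  "int (Suc r) ^ 2 * lin_coeff (Suc r) s (Suc k) =
     int (Suc k) ^ 2 * lin_coeff r s k +
     (int r - int (Suc k)) * (int r + int k + 2) * lin_coeff r s (Suc k)"
proof -
  \<comment> \<open>Suffix 1 marks the binomials of the left-hand side, suffix 2 those of the last
    term; \<open>B\<close> occurs in both.\<close>
  define a b c where "a = int (k choose r)" "b = int (k choose s)" "c = int ((r + s) choose k)"
  define a1 B c1 where "a1 = int (Suc k choose Suc r)" "B = int (Suc k choose s)"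
    "c1 = int (Suc (r + s) choose Suc k)"
  define a2 c2 where "a2 = int (Suc k choose r)" "c2 = int ((r + s) choose Suc k)"
  have 1: "int (Suc r) * a1 = int (Suc k) * a"
    unfolding a_b_c_def a1_B_c1_def by (metis Suc_times_binomial of_nat_mult)
  have 2: "int (Suc k) * c1 = (int r + int s + 1) * c"
    unfolding a_b_c_def a1_B_c1_def
    using arg_cong[OF Suc_times_binomial[of k "r + s"], of int] by (simp add: algebra_simps)
  have 3: "(int (Suc k) - int r) * a2 = int (Suc k) * a"
    unfolding a_b_c_def a2_c2_def by (rule binomial_absorb_upper)
  have 4: "(int (Suc k) - int s) * B = int (Suc k) * b"
    unfolding a_b_c_def a1_B_c1_def by (rule binomial_absorb_upper)
  have 5: "int (Suc k) * c2 = (int r + int s - int k) * c"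
    unfolding a_b_c_def a2_c2_def using binomial_absorb_lower[of k "r + s"] by simp
  have L: "int (Suc r) ^ 2 * (a1 * B * c1) = int (Suc r) * (int r + int s + 1) * a * B * c"
  proof -
    have "int (Suc r) ^ 2 * (a1 * B * c1) = int (Suc r) * (int (Suc r) * a1) * B * c1"
      by (simp add: power2_eq_square)
    also have "\<dots> = int (Suc r) * a * B * (int (Suc k) * c1)"
      by (subst 1) (simp only: mult_ac)
    also have "\<dots> = int (Suc r) * (int r + int s + 1) * a * B * c"
      by (subst 2) (simp only: mult_ac)
    finally show ?thesis .
  qed
  have R1: "int (Suc k) ^ 2 * (a * b * c) = int (Suc k) * (int (Suc k) - int s) * a * B * c"
  proof -
    have "int (Suc k) ^ 2 * (a * b * c) = int (Suc k) * a * (int (Suc k) * b) * c"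
      by (simp add: power2_eq_square)
    also have "\<dots> = int (Suc k) * (int (Suc k) - int s) * a * B * c"
      by (subst 4[symmetric]) (simp only: mult_ac)
    finally show ?thesis .
  qed
  have R2: "(int (Suc k) - int r) * (int r + int k + 2) * (a2 * B * c2) =
      (int r + int k + 2) * (int r + int s - int k) * a * B * c"
  proof -
    have "(int (Suc k) - int r) * (int r + int k + 2) * (a2 * B * c2) =
        ((int (Suc k) - int r) * a2) * (int r + int k + 2) * B * c2" by (simp only: mult_ac)
    also have "\<dots> = (int r + int k + 2) * a * B * (int (Suc k) * c2)" by (subst 3) (simp only: mult_ac)
    also have "\<dots> = (int r + int k + 2) * (int r + int s - int k) * a * B * c"
      by (subst 5) (simp only: mult_ac)
    finally show ?thesis .
  qed
  define e :: int where "e = (-1) ^ (r + s + k)"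
  have C: "lin_coeff (Suc r) s (Suc k) = e * (a1 * B * c1)" "lin_coeff r s k = e * (a * b * c)"
      "lin_coeff r s (Suc k) = - (e * (a2 * B * c2))"
    unfolding lin_coeff_def a_b_c_def a1_B_c1_def a2_c2_def e_def by simp_all
  \<comment> \<open>What remains is (r+1)(r+s+1) = (k+1)(k+1-s) + (r+k+2)(r+s-k).\<close>
  have eq: "int (Suc r) ^ 2 * (a1 * B * c1) = int (Suc k) ^ 2 * (a * b * c) +
      (int (Suc k) - int r) * (int r + int k + 2) * (a2 * B * c2)"
    unfolding L R1 R2 by (simp add: algebra_simps)
  have "int (Suc r) ^ 2 * (e * (a1 * B * c1)) = e * (int (Suc r) ^ 2 * (a1 * B * c1))"
    by (rule mult.left_commute)
  also have "\<dots> = int (Suc k) ^ 2 * (e * (a * b * c)) +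
      (int r - int (Suc k)) * (int r + int k + 2) * - (e * (a2 * B * c2))"
    unfolding eq by (simp add: algebra_simps)
  finally show ?thesis unfolding C .
qed

lemma lin_coeff_0_left: "lin_coeff 0 s k = (if k = s then 1 else 0)"
  by (cases k s rule: linorder_cases) (simp_all add: lin_coeff_def)

text \<open>Induction on r: (r+1)^2 times the sum for \<open>Suc r\<close> is rewritten by
  \<open>lin_coeff_rec\<close> and the recurrence of u. It collapses to (r(r+1) - c) u_r u_s, which
  is (r+1)^2 u_{r+1} u_s. The constant c cancels from the coefficients.\<close>

lemma product_linearization:
  fixes u :: "nat \<Rightarrow> 'a::field_char_0" and c :: 'a
  assumes u0: "u 0 = 1"
    and rec: "\<And>k. of_nat (Suc k) ^ 2 * u (Suc k) = (of_nat k * of_nat (Suc k) - c) * u k"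
  shows "u r * u s = (\<Sum>k\<le>r+s. of_int (lin_coeff r s k) * u k)"
proof (induction r)
  case 0
  have "(\<Sum>k\<le>s. of_int (lin_coeff 0 s k) * u k) = (\<Sum>k\<le>s. if k = s then u k else 0)"
    by (intro sum.cong) (auto simp: lin_coeff_0_left)
  thus ?case by (simp add: u0)
next
  case (Suc r)
  let ?M = "r + s" and ?C = "\<lambda>r k. of_int (lin_coeff r s k) :: 'a"
  let ?g = "\<lambda>k. (of_nat r - of_nat k) * (of_nat r + of_nat k + 1) * ?C r k * u k"
  have rec_C: "of_nat (Suc r) ^ 2 * ?C (Suc r) (Suc k) =
      of_nat (Suc k) ^ 2 * ?C r k + (of_nat r - of_nat (Suc k)) * (of_nat r + of_nat k + 2) * ?C r (Suc k)"
    for k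
    using arg_cong[OF lin_coeff_rec[of r s k], of "of_int :: int \<Rightarrow> 'a"] by simp
  have "of_nat (Suc r) ^ 2 * (\<Sum>k\<le>Suc ?M. ?C (Suc r) k * u k) =
      (\<Sum>k\<le>?M. (of_nat (Suc r) ^ 2 * ?C (Suc r) (Suc k)) * u (Suc k))"
    by (subst sum.atMost_Suc_shift) (simp add: lin_coeff_eq_0 sum_distrib_left mult_ac)
  also have "\<dots> = (\<Sum>k\<le>?M. ?C r k * (of_nat (Suc k) ^ 2 * u (Suc k))) + (\<Sum>k\<le>?M. ?g (Suc k))"
    unfolding rec_C sum.distrib[symmetric]
    by (intro sum.cong refl) (simp add: algebra_simps)
  \<comment> \<open>The added term \<open>?g 0\<close> is 0: for r = 0 through the factor r - k,
    otherwise because \<open>lin_coeff r s 0\<close> vanishes.\<close>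
  also have "(\<Sum>k\<le>?M. ?g (Suc k)) = (\<Sum>k\<le>Suc ?M. ?g k)"
    using sum.atMost_Suc_shift[of ?g ?M]
    by (cases r) (simp_all add: lin_coeff_eq_0 del: sum.atMost_Suc)
  also have "\<dots> = (\<Sum>k\<le>?M. ?g k)"
    by (simp add: lin_coeff_eq_0)
  \<comment> \<open>The dependence on k disappears because k(k+1) + (r-k)(r+k+1) = r(r+1).\<close>
  also have "(\<Sum>k\<le>?M. ?C r k * (of_nat (Suc k) ^ 2 * u (Suc k))) + (\<Sum>k\<le>?M. ?g k) =
      (\<Sum>k\<le>?M. (of_nat r * of_nat (Suc r) - c) * (?C r k * u k))"
    unfolding rec sum.distrib[symmetric]
    by (intro sum.cong refl) (simp add: algebra_simps)
  also have "\<dots> = (of_nat r * of_nat (Suc r) - c) * (u r * u s)"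
    by (simp only: sum_distrib_left Suc.IH)
  also have "\<dots> = of_nat (Suc r) ^ 2 * (u (Suc r) * u s)"
    by (simp only: mult.assoc[symmetric] rec)
  finally have "of_nat (Suc r) ^ 2 * (\<Sum>k\<le>Suc ?M. ?C (Suc r) k * u k) = of_nat (Suc r) ^ 2 * (u (Suc r) * u s)" .
  moreover have "(of_nat (Suc r) :: 'a) ^ 2 \<noteq> 0"
    by (simp del: of_nat_Suc)
  ultimately have "(\<Sum>k\<le>Suc ?M. ?C (Suc r) k * u k) = u (Suc r) * u s"
    by (simp only: mult_cancel_left) simp
  thus ?case by simp
qed


section \<open>Trinomial coefficients\<close>

text \<open>Substituting x t for t turns t^2 + bxt + cx^2 into x^2 (t^2 + bt + c). Comparing
  coefficients of t^n and cancelling x^n gives the claim for nonzero x; for x = 0 the polynomial is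
  t^2.\<close>

lemma coeff_trinomial_scale:
  fixes x :: "'a::field"
  shows "coeff ([:c * x ^ 2, b * x, 1:] ^ n) n = x ^ n * coeff ([:c, b, 1:] ^ n) n"
proof (cases "x = 0")
  case True
  have "[:0, 0, 1::'a:] = monom 1 2"
    by (simp add: monom_altdef power2_eq_square)
  thus ?thesis using True by (simp add: monom_power coeff_monom)
next
  case False
  have lin: "pcompose [:c * x ^ 2, b * x, 1:] [:0, x:] = smult (x ^ 2) [:c, b, 1:]"
    by (simp add: pcompose_pCons power2_eq_square algebra_simps)
  have "pcompose (q ^ n) r = pcompose q r ^ n" for q r :: "'a poly"
    by (induction n) (simp_all add: pcompose_mult pcompose_1)
  hence "pcompose ([:c * x ^ 2, b * x, 1:] ^ n) [:0, x:] = smult (x ^ (2 * n)) ([:c, b, 1:] ^ n)"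
    by (simp only: lin smult_power power_mult)
  hence "coeff (pcompose ([:c * x ^ 2, b * x, 1:] ^ n) [:0, x:]) n =
      x ^ n * (x ^ n * coeff ([:c, b, 1:] ^ n) n)"
    by (simp add: mult_2 power_add)
  hence "x ^ n * coeff ([:c * x ^ 2, b * x, 1:] ^ n) n = x ^ n * (x ^ n * coeff ([:c, b, 1:] ^ n) n)"
    by (simp only: coeff_pcompose_linear)
  thus ?thesis using False by simp
qed

text \<open>The quadratic is (t + g)(t + h), so the coefficient is the convolution of two binomial
  expansions.\<close>

lemma coeff_trinomial_factored:
  fixes g h :: "'a::comm_ring_1"
  shows "coeff ([:g * h, g + h, 1:] ^ n) n = (\<Sum>j\<le>n. of_nat (n choose j) ^ 2 * g ^ j * h ^ (n - j))"
proof -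
  have "[:g * h, g + h, 1:] = [:h, 1:] * [:g, 1:]" by (simp add: algebra_simps)
  hence "coeff ([:g * h, g + h, 1:] ^ n) n =
      (\<Sum>j\<le>n. coeff ([:h, 1:] ^ n) j * coeff ([:g, 1:] ^ n) (n - j))"
    by (simp only: power_mult_distrib coeff_mult)
  also have "\<dots> = (\<Sum>j\<le>n. of_nat (n choose j) ^ 2 * g ^ j * h ^ (n - j))"
    by (intro sum.cong refl)
      (auto simp: coeff_linear_poly_power power2_eq_square mult_ac simp flip: binomial_symmetric)
  finally show ?thesis .
qed

lemma of_int_trinomial:
  "(of_int (trinomial n b c) :: 'a::comm_ring_1) = coeff ([:of_int c, of_int b, 1:] ^ n) n"
proof -
  have hom: "map_poly of_int (p * q) = map_poly of_int p * (map_poly of_int q :: 'a poly)" for p q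
    by (rule poly_eqI) (simp add: coeff_map_poly coeff_mult)
  have "map_poly of_int (q ^ n) = (map_poly of_int q :: 'a poly) ^ n" for q
    by (induction n) (simp_all add: hom map_poly_pCons)
  hence "coeff (map_poly of_int ([:c, b, 1:] ^ n)) n = coeff ((map_poly of_int [:c, b, 1:] :: 'a poly) ^ n) n"
    by simp
  thus ?thesis by (simp add: trinomial_def coeff_map_poly map_poly_pCons)
qed

text \<open>Expand (1-y)^(k-j), set r = j + i and use C(k,j) C(k-j,i) = C(k,r) C(r,j). Terms with r
  < j vanish, so r may run from 0.\<close>

lemma binomial_times_power_expand:
  fixes y :: "'a::comm_ring_1"
  assumes "j \<le> k"
  shows "of_nat (k choose j) * y ^ j * (1 - y) ^ (k - j) =
    (\<Sum>r\<le>k. (-1) ^ (r + j) * of_nat ((k choose r) * (r choose j)) * y ^ r)"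
proof -
  have "(1 - y) ^ (k - j) = (\<Sum>i\<le>k-j. of_nat ((k - j) choose i) * (- y) ^ i)"
    using binomial_ring[of "- y" 1 "k - j"] by simp
  hence "of_nat (k choose j) * y ^ j * (1 - y) ^ (k - j) =
      (\<Sum>i\<le>k-j. of_nat ((k choose j) * ((k - j) choose i)) * (y ^ j * (- y) ^ i))"
    by (simp add: sum_distrib_left mult_ac)
  also have "\<dots> = (\<Sum>i\<le>k-j. (-1) ^ ((j + i) + j) * of_nat ((k choose (j + i)) * ((j + i) choose j)) * y ^ (j + i))"
  proof (intro sum.cong refl)
    fix i assume i: "i \<in> {..k-j}"
    have "(k choose j) * ((k - j) choose i) = (k choose (j + i)) * ((j + i) choose j)"
      using choose_mult[of j "j + i" k] i assms by simp
    moreover have "y ^ j * (- y) ^ i = (-1) ^ ((j + i) + j) * y ^ (j + i)"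
      by (simp add: power_minus[of y] power_add mult_ac flip: mult_2 power_mult)
    ultimately show "of_nat ((k choose j) * ((k - j) choose i)) * (y ^ j * (- y) ^ i) =
        (-1) ^ ((j + i) + j) * of_nat ((k choose (j + i)) * ((j + i) choose j)) * y ^ (j + i)"
      by (simp only: mult_ac)
  qed
  also have "\<dots> = (\<Sum>r\<in>{j..k}. (-1) ^ (r + j) * of_nat ((k choose r) * (r choose j)) * y ^ r)"
    using assms by (intro sum.reindex_bij_witness[of _ "\<lambda>r. r - j" "\<lambda>i. j + i"]) auto
  also have "\<dots> = (\<Sum>r\<le>k. (-1) ^ (r + j) * of_nat ((k choose r) * (r choose j)) * y ^ r)"
    by (intro sum.mono_neutral_left) (auto simp: not_le binomial_eq_0)
  finally show ?thesis .
qed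

text \<open>Writing C(k,j)^2 as C(k,j) C(k,k-j) splits each summand into an expansion in y with
  index j and one in z with index k-j. The sum over j is then Vandermonde's and gives
  C(r+s,k).\<close>

lemma trinomial_expand:
  fixes y z :: "'a::comm_ring_1"
  shows "(\<Sum>j\<le>k. of_nat (k choose j) ^ 2 * (y * (1 - z)) ^ j * (z * (1 - y)) ^ (k - j)) =
    (\<Sum>r\<le>k. \<Sum>s\<le>k. of_int (lin_coeff r s k) * y ^ r * z ^ s)"
proof -
  have *: "of_nat (k choose j) ^ 2 * (y * (1 - z)) ^ j * (z * (1 - y)) ^ (k - j) =
      (\<Sum>r\<le>k. \<Sum>s\<le>k. (-1) ^ (r + s + k) * of_nat ((k choose r) * (k choose s)) * y ^ r * z ^ s *
        of_nat ((r choose j) * (s choose (k - j))))" if "j \<le> k" for j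
  proof -
    have sgn: "(-1) ^ (r + j) * (-1) ^ (s + (k - j)) = ((-1) ^ (r + s + k) :: 'a)" for r s
    proof -
      have "r + j + (s + (k - j)) = r + s + k" using that by simp
      thus ?thesis by (simp only: power_add[symmetric])
    qed
    have "of_nat (k choose j) ^ 2 * (y * (1 - z)) ^ j * (z * (1 - y)) ^ (k - j) =
        (of_nat (k choose j) * y ^ j * (1 - y) ^ (k - j)) *
        (of_nat (k choose (k - j)) * z ^ (k - j) * (1 - z) ^ (k - (k - j)))"
      using that by (simp add: power2_eq_square power_mult_distrib mult_ac flip: binomial_symmetric)
    also have "\<dots> = (\<Sum>r\<le>k. \<Sum>s\<le>k. ((-1) ^ (r + j) * of_nat ((k choose r) * (r choose j)) * y ^ r) *
        ((-1) ^ (s + (k - j)) * of_nat ((k choose s) * (s choose (k - j))) * z ^ s))"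
      using that by (simp only: binomial_times_power_expand diff_le_self sum_product)
    also have "\<dots> = (\<Sum>r\<le>k. \<Sum>s\<le>k. ((-1) ^ (r + j) * (-1) ^ (s + (k - j))) *
        of_nat ((k choose r) * (k choose s)) * y ^ r * z ^ s * of_nat ((r choose j) * (s choose (k - j))))"
      by (intro sum.cong refl) (simp add: mult_ac)
    finally show ?thesis by (simp only: sgn)
  qed
  have "(\<Sum>j\<le>k. of_nat (k choose j) ^ 2 * (y * (1 - z)) ^ j * (z * (1 - y)) ^ (k - j)) =
      (\<Sum>j\<le>k. \<Sum>r\<le>k. \<Sum>s\<le>k. (-1) ^ (r + s + k) * of_nat ((k choose r) * (k choose s)) * y ^ r * z ^ s *
        of_nat ((r choose j) * (s choose (k - j))))"
    by (intro sum.cong refl *) simp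
  also have "\<dots> = (\<Sum>r\<le>k. \<Sum>s\<le>k. \<Sum>j\<le>k. (-1) ^ (r + s + k) * of_nat ((k choose r) * (k choose s)) * y ^ r * z ^ s *
        of_nat ((r choose j) * (s choose (k - j))))"
    by (rule trans[OF sum.swap], rule sum.cong[OF refl], rule sum.swap)
  also have "\<dots> = (\<Sum>r\<le>k. \<Sum>s\<le>k. (-1) ^ (r + s + k) * of_nat ((k choose r) * (k choose s)) * y ^ r * z ^ s *
        of_nat (\<Sum>j\<le>k. (r choose j) * (s choose (k - j))))"
    by (simp only: of_nat_sum sum_distrib_left)
  also have "\<dots> = (\<Sum>r\<le>k. \<Sum>s\<le>k. of_int (lin_coeff r s k) * y ^ r * z ^ s)"
    unfolding vandermonde by (simp add: lin_coeff_def mult_ac)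
  finally show ?thesis .
qed


section \<open>Divisibility of binomial coefficients\<close>

text \<open>p^a divides i C(p^a,i); were p not to divide the binomial, p^a would divide i, although
  0 < i < p^a.\<close>

lemma prime_dvd_binomial_prime_power:
  fixes p :: nat
  assumes "prime p" "0 < i" "i < p ^ a"
  shows "p dvd (p ^ a choose i)"
proof (rule ccontr)
  assume "\<not> p dvd (p ^ a choose i)"
  hence "coprime (p ^ a) (p ^ a choose i)"
    using assms(1) by (simp add: prime_imp_coprime)
  moreover have "p ^ a dvd i * (p ^ a choose i)"
    using times_binomial_minus1_eq[OF assms(2), of "p ^ a"] by simp
  ultimately have "p ^ a dvd i" by (simp add: coprime_dvd_mult_left_iff)
  thus False using assms by (auto dest: dvd_imp_le)
qed

text \<open>The carry case of Kummer's theorem. With i + j = p^a + m, Vandermonde leaves terms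
  C(p^a,l) C(m,i-l): for l = 0 the second factor vanishes since m < i, for l > 0 the first is
  divisible by p.\<close>

lemma prime_dvd_binomial_add:
  fixes p :: nat
  assumes "prime p" "i < p ^ a" "j < p ^ a" "p ^ a \<le> i + j"
  shows "p dvd ((i + j) choose i)"
proof -
  define m where "m = i + j - p ^ a"
  have m: "i + j = p ^ a + m" "m < i" using assms by (auto simp: m_def)
  have "(i + j) choose i = (\<Sum>l\<le>i. (p ^ a choose l) * (m choose (i - l)))"
    by (simp only: m(1) vandermonde)
  also have "p dvd \<dots>"
  proof (rule dvd_sum)
    fix l assume "l \<in> {..i}"
    thus "p dvd (p ^ a choose l) * (m choose (i - l))"
      using m(2) assms prime_dvd_binomial_prime_power[OF assms(1), of l a]
      by (cases "l = 0") (auto simp: binomial_eq_0)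
  qed
  finally show ?thesis .
qed

text \<open>For k \<le> r + s, both k - r \<le> s and k - s \<le> r lie below p^a. Adding r to k -
  r, or s to k - s, therefore reaches p^a, and C(k,r) and C(k,s) contribute one factor p
  each.\<close>

lemma lin_coeff_dvd:
  fixes p :: nat
  assumes "prime p" "r < p ^ a" "s < p ^ a" "p ^ a \<le> k"
  shows "int p ^ 2 dvd lin_coeff r s k"
proof (cases "k \<le> r + s")
  case True
  have "p dvd ((r + (k - r)) choose r)" "p dvd ((s + (k - s)) choose s)"
    using assms True by (intro prime_dvd_binomial_add[of p _ a]; simp)+
  hence "p * p dvd (k choose r) * (k choose s)"
    using assms by (intro mult_dvd_mono) auto
  hence "p ^ 2 dvd (k choose r) * (k choose s) * ((r + s) choose k)"
    by (simp add: power2_eq_square)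
  hence "int (p ^ 2) dvd int ((k choose r) * (k choose s) * ((r + s) choose k))"
    by (simp only: of_nat_dvd_iff)
  thus ?thesis unfolding lin_coeff_def by simp
qed (simp add: lin_coeff_eq_0)


section \<open>The truncated product formula\<close>

text \<open>An abstract home for the quotients by p^2. It is instantiated later by an explicit ring
  of integral elements that contains both square roots.\<close>

locale unital_subring =
  fixes S :: "'a::field_char_0 set"
  assumes one_mem [intro, simp]: "1 \<in> S"
    and diff_mem [intro]: "x \<in> S \<Longrightarrow> y \<in> S \<Longrightarrow> x - y \<in> S"
    and mult_mem [intro]: "x \<in> S \<Longrightarrow> y \<in> S \<Longrightarrow> x * y \<in> S"
begin

lemma zero_mem [intro, simp]: "0 \<in> S"
  using diff_mem[OF one_mem one_mem] by simp

lemma uminus_mem [intro]: "x \<in> S \<Longrightarrow> - x \<in> S"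
  using diff_mem[OF zero_mem] by force

lemma add_mem [intro]: "x \<in> S \<Longrightarrow> y \<in> S \<Longrightarrow> x + y \<in> S"
  using diff_mem[OF _ uminus_mem] by force

lemma power_mem [intro]: "x \<in> S \<Longrightarrow> x ^ n \<in> S"
  by (induction n) auto

lemma sum_mem [intro]: "(\<And>i. i \<in> I \<Longrightarrow> f i \<in> S) \<Longrightarrow> sum f I \<in> S"
  by (induction I rule: infinite_finite_induct) auto

lemma of_nat_mem [intro, simp]: "of_nat n \<in> S"
  by (induction n) auto

lemma of_int_mem [intro, simp]: "of_int n \<in> S"
  by (cases n rule: int_cases2) auto

text \<open>Linearising the product of the truncated sums gives terms with k < 2N. Those with k < N
  make up the first sum exactly, by \<open>trinomial_expand\<close>; those with k \<ge> N carry the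
  factor p^2.\<close>

lemma truncated_product:
  fixes u :: "nat \<Rightarrow> 'a" and c y z :: 'a and p a :: nat
  assumes "u 0 = 1"
    and "\<And>k. of_nat (Suc k) ^ 2 * u (Suc k) = (of_nat k * of_nat (Suc k) - c) * u k"
    and u: "\<And>k. u k \<in> S" and yz: "y \<in> S" "z \<in> S" and p: "prime p"
  defines "N \<equiv> p ^ a"
  shows "\<exists>w\<in>S. (\<Sum>k<N. u k * (\<Sum>j\<le>k. of_nat (k choose j) ^ 2 * (y * (1 - z)) ^ j * (z * (1 - y)) ^ (k - j)))
           - (\<Sum>k<N. u k * y ^ k) * (\<Sum>k<N. u k * z ^ k) = of_nat (p ^ 2) * w"
proof -
  let ?C = "\<lambda>r s k. of_int (lin_coeff r s k) :: 'a"
  \<comment> \<open>The division is known to be exact for r, s < N \<le> k, the only range in which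
    \<open>E\<close> is used.\<close>
  define E where "E r s k = lin_coeff r s k div int p ^ 2" for r s k
  have E: "?C r s k = of_nat (p ^ 2) * of_int (E r s k)" if "r < N" "s < N" "N \<le> k" for r s k
  proof -
    have "lin_coeff r s k = int p ^ 2 * E r s k"
      unfolding E_def using lin_coeff_dvd[OF p] that by (simp add: N_def)
    thus ?thesis by simp
  qed
  \<comment> \<open>For k < N the ranges r, s \<le> k extend to r, s < N at no cost, so that the
    bounds no longer depend on k and the sums can be swapped.\<close>
  have Q: "(\<Sum>j\<le>k. of_nat (k choose j) ^ 2 * (y * (1 - z)) ^ j * (z * (1 - y)) ^ (k - j)) =
      (\<Sum>r<N. \<Sum>s<N. ?C r s k * y ^ r * z ^ s)" if "k < N" for k
  proof -
    have "(\<Sum>r<N. \<Sum>s<N. ?C r s k * y ^ r * z ^ s) = (\<Sum>r<N. \<Sum>s\<le>k. ?C r s k * y ^ r * z ^ s)"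
      using that by (intro sum.cong refl sum.mono_neutral_right) (auto simp: lin_coeff_eq_0)
    also have "\<dots> = (\<Sum>r\<le>k. \<Sum>s\<le>k. ?C r s k * y ^ r * z ^ s)"
      using that by (intro sum.mono_neutral_right) (auto simp: lin_coeff_eq_0)
    finally show ?thesis by (simp only: trinomial_expand)
  qed
  have "(\<Sum>k<N. u k * (\<Sum>j\<le>k. of_nat (k choose j) ^ 2 * (y * (1 - z)) ^ j * (z * (1 - y)) ^ (k - j))) =
      (\<Sum>k<N. \<Sum>r<N. \<Sum>s<N. ?C r s k * u k * (y ^ r * z ^ s))"
    by (intro sum.cong refl, subst Q) (simp_all add: sum_distrib_left mult_ac)
  also have "\<dots> = (\<Sum>r<N. \<Sum>s<N. \<Sum>k<N. ?C r s k * u k * (y ^ r * z ^ s))"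
    by (rule trans[OF sum.swap], rule sum.cong[OF refl], rule sum.swap)
  also have "\<dots> = (\<Sum>r<N. \<Sum>s<N. (\<Sum>k<N. ?C r s k * u k) * (y ^ r * z ^ s))"
    by (simp only: sum_distrib_right)
  finally have 1: "(\<Sum>k<N. u k * (\<Sum>j\<le>k. of_nat (k choose j) ^ 2 * (y * (1 - z)) ^ j * (z * (1 - y)) ^ (k - j))) = \<dots>" .
  have lin: "u r * u s = (\<Sum>k<N. ?C r s k * u k) + of_nat (p ^ 2) * (\<Sum>k=N..<2*N. of_int (E r s k) * u k)"
    if "r < N" "s < N" for r s
  proof -
    have "u r * u s = (\<Sum>k\<le>r+s. ?C r s k * u k)"
      by (rule product_linearization) fact+
    also have "\<dots> = (\<Sum>k<2*N. ?C r s k * u k)"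
      using that by (intro sum.mono_neutral_left) (auto simp: lin_coeff_eq_0)
    also have "\<dots> = (\<Sum>k<N. ?C r s k * u k) + (\<Sum>k=N..<2*N. ?C r s k * u k)"
      using sum.atLeastLessThan_concat[of 0 N "2 * N" "\<lambda>k. ?C r s k * u k"]
      by (simp add: atLeast0LessThan)
    also have "(\<Sum>k=N..<2*N. ?C r s k * u k) = (\<Sum>k=N..<2*N. of_nat (p ^ 2) * (of_int (E r s k) * u k))"
      using that by (intro sum.cong refl) (simp only: E atLeastLessThan_iff mult.assoc)
    finally show ?thesis by (simp only: sum_distrib_left)
  qed
  define w where "w = (\<Sum>r<N. \<Sum>s<N. (\<Sum>k=N..<2*N. of_int (E r s k) * u k) * (y ^ r * z ^ s))"
  have "(\<Sum>k<N. u k * y ^ k) * (\<Sum>k<N. u k * z ^ k) = (\<Sum>r<N. \<Sum>s<N. (u r * u s) * (y ^ r * z ^ s))"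
    by (simp add: sum_product mult_ac)
  also have "\<dots> = (\<Sum>r<N. \<Sum>s<N. (\<Sum>k<N. ?C r s k * u k) * (y ^ r * z ^ s)) + of_nat (p ^ 2) * w"
    unfolding w_def sum_distrib_left sum.distrib[symmetric]
    by (intro sum.cong refl) (simp add: lin distrib_right mult.assoc flip: sum_distrib_left)
  finally have "(\<Sum>k<N. u k * (\<Sum>j\<le>k. of_nat (k choose j) ^ 2 * (y * (1 - z)) ^ j * (z * (1 - y)) ^ (k - j)))
      - (\<Sum>k<N. u k * y ^ k) * (\<Sum>k<N. u k * z ^ k) = of_nat (p ^ 2) * (- w)"
    unfolding 1 by simp
  moreover have "- w \<in> S"
    unfolding w_def using u yz by blast
  ultimately show ?thesis by blast
qed

end


section \<open>An integral extension containing the square roots\<close>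

lemma of_padic_int_hom [simp]:
  "of_padic_int 0 = 0" "of_padic_int 1 = 1"
  "of_padic_int (x + y) = of_padic_int x + of_padic_int y"
  "of_padic_int (x - y) = of_padic_int x - of_padic_int y"
  "of_padic_int (x * y) = of_padic_int x * of_padic_int y"
  "of_padic_int (- x) = - of_padic_int x"
  by (simp_all add: of_padic_int_def)

lemma of_padic_int_power [simp]: "of_padic_int (x ^ n) = of_padic_int x ^ n"
  by (induction n) simp_all

lemma of_padic_int_of_nat [simp]: "of_padic_int (of_nat n) = of_nat n"
  by (induction n) simp_all

lemma of_padic_int_of_int [simp]: "of_padic_int (of_int n) = of_int n"
  by (cases n rule: int_cases2) simp_all

lemma of_padic_int_numeral [simp]: "of_padic_int (numeral n) = numeral n"
  using of_padic_int_of_nat[of "numeral n"] by (simp del: of_padic_int_of_nat)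

text \<open>Choose an inverse of m modulo each power of p; uniqueness of inverses makes the residues
  compatible, so they define a p-adic integer.\<close>

lemma of_nat_unit_padic_int:
  assumes "coprime m (CARD('p::prime_card))"
  obtains v :: "'p::prime_card padic_int" where "of_nat m * v = 1"
proof -
  let ?q = "int CARD('p)"
  have q: "?q > 0" by (simp add: prime_card prime_gt_0_nat)
  have cop: "coprime (int m) (?q ^ n)" for n
    using assms by simp
  have "\<exists>v. (int m * v) mod ?q ^ n = 1 mod ?q ^ n" for n
    using cong_solve_coprime_int[OF cop[of n]] by (auto simp: unique_euclidean_semiring_class.cong_def)
  then obtain g where g: "\<And>n. (int m * g n) mod ?q ^ n = 1 mod ?q ^ n" by metis
  define f where "f n = g n mod ?q ^ n" for n
  have f: "(int m * f n) mod ?q ^ n = 1 mod ?q ^ n" for n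
    unfolding f_def by (simp add: mod_mult_right_eq g)
  have step: "f (Suc n) mod ?q ^ n = f n" for n
  proof -
    have "(int m * f (Suc n)) mod ?q ^ Suc n mod ?q ^ n = 1 mod ?q ^ Suc n mod ?q ^ n"
      by (simp only: f)
    hence "(int m * f (Suc n)) mod ?q ^ n = (int m * f n) mod ?q ^ n"
      by (simp add: mod_mod_cancel f)
    \<comment> \<open>Both residues are inverses of m modulo q^n, and m can be cancelled.\<close>
    hence "?q ^ n dvd int m * (f (Suc n) - f n)"
      by (simp add: mod_eq_dvd_iff right_diff_distrib)
    hence "?q ^ n dvd f (Suc n) - f n"
      using cop[of n] by (simp add: coprime_commute coprime_dvd_mult_right_iff)
    hence "f (Suc n) mod ?q ^ n = f n mod ?q ^ n"
      by (simp add: mod_eq_dvd_iff)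
    thus ?thesis by (simp add: f_def)
  qed
  have mem: "f \<in> {f. \<forall>n. f n \<in> {0..<?q ^ n} \<and> f (Suc n) mod ?q ^ n = f n}"
    using step q by (auto simp: f_def)
  have "of_nat m * (Abs_padic_int f :: 'p padic_int) = 1"
  proof (rule Rep_padic_int_inject[THEN iffD1], rule ext)
    fix n
    show "Rep_padic_int (of_nat m * (Abs_padic_int f :: 'p padic_int)) n = Rep_padic_int (1 :: 'p padic_int) n"
      by (simp add: times_padic_int.rep_eq one_padic_int.rep_eq Rep_padic_int_of_nat
        Abs_padic_int_inverse[OF mem] mod_mult_left_eq f)
  qed
  thus ?thesis by (rule that)
qed

section \<open>The ring generated by the two square roots\<close>

text \<open>When s^2 and t^2 are p-adic integers this is Z_p[s,t], spanned by 1, s, t and st; the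
  representation may fail to be unique.\<close>

definition biquadratic_ring ::
    "'p::prime_card padic alg_closure \<Rightarrow> 'p padic alg_closure \<Rightarrow> 'p padic alg_closure set" where
  "biquadratic_ring s t = {of_padic_int \<alpha> + of_padic_int \<beta> * s + (of_padic_int \<gamma> + of_padic_int \<delta> * s) * t
     | \<alpha> \<beta> \<gamma> \<delta>. True}"

lemma biquadratic_ringI:
  "w = of_padic_int \<alpha> + of_padic_int \<beta> * s + (of_padic_int \<gamma> + of_padic_int \<delta> * s) * t \<Longrightarrow>
     w \<in> biquadratic_ring s t"
  unfolding biquadratic_ring_def by blast

lemma unital_subring_biquadratic_ring:
  assumes s: "s ^ 2 = of_padic_int A" and t: "t ^ 2 = of_padic_int B"
  shows "unital_subring (biquadratic_ring s t)"
proof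
  show "1 \<in> biquadratic_ring s t"
    by (rule biquadratic_ringI[of _ 1 0 _ 0 0]) simp
next
  fix x y assume "x \<in> biquadratic_ring s t" "y \<in> biquadratic_ring s t"
  then obtain \<alpha> \<beta> \<gamma> \<delta> \<alpha>' \<beta>' \<gamma>' \<delta>' where
    x: "x = of_padic_int \<alpha> + of_padic_int \<beta> * s + (of_padic_int \<gamma> + of_padic_int \<delta> * s) * t" and
    y: "y = of_padic_int \<alpha>' + of_padic_int \<beta>' * s + (of_padic_int \<gamma>' + of_padic_int \<delta>' * s) * t"
    unfolding biquadratic_ring_def by blast
  show "x - y \<in> biquadratic_ring s t"
    by (rule biquadratic_ringI[of _ "\<alpha> - \<alpha>'" "\<beta> - \<beta>'" _ "\<gamma> - \<gamma>'" "\<delta> - \<delta>'"])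
      (simp add: x y algebra_simps)
  have ss: "s * (s * w) = of_padic_int A * w" and tt: "t * (t * w) = of_padic_int B * w"
    and ss': "s * s = of_padic_int A" and tt': "t * t = of_padic_int B" for w
    using s t by (simp_all add: power2_eq_square flip: mult.assoc)
  show "x * y \<in> biquadratic_ring s t"
    \<comment> \<open>The witnesses are the coefficients of 1, s, t and st in the expanded product,
      with s^2 replaced by A and t^2 by B.\<close>
    by (rule biquadratic_ringI[of _ "\<alpha> * \<alpha>' + \<beta> * \<beta>' * A + B * (\<gamma> * \<gamma>' + \<delta> * \<delta>' * A)" "\<alpha> * \<beta>' + \<beta> * \<alpha>' + B * (\<gamma> * \<delta>' + \<delta> * \<gamma>')" _
       "\<alpha> * \<gamma>' + \<beta> * \<delta>' * A + \<gamma> * \<alpha>' + \<delta> * \<beta>' * A" "\<alpha> * \<delta>' + \<beta> * \<gamma>' + \<gamma> * \<beta>' + \<delta> * \<alpha>'"])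
      (simp add: x y algebra_simps ss tt ss' tt')
qed

lemma of_padic_int_in_biquadratic_ring [intro]: "of_padic_int x \<in> biquadratic_ring s t"
  by (rule biquadratic_ringI[of _ x 0 _ 0 0]) simp

lemma sqrt_in_biquadratic_ring [intro]: "s \<in> biquadratic_ring s t" "t \<in> biquadratic_ring s t"
  by (rule biquadratic_ringI[of _ 0 1 _ 0 0]; simp)
    (rule biquadratic_ringI[of _ 0 0 _ 1 0]; simp)

text \<open>This keeps the denominators of the sums inside the ring, since they are units of the
  p-adic integers.\<close>

lemma inverse_in_biquadratic_ring:
  fixes s t :: "'p::prime_card padic alg_closure"
  assumes "coprime m CARD('p)"
  shows "inverse (of_nat m) \<in> biquadratic_ring s t"
proof -
  obtain v :: "'p padic_int" where v: "of_nat m * v = 1"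
    using of_nat_unit_padic_int[OF assms] .
  have "of_nat m * of_padic_int v = 1"
    using arg_cong[OF v, of of_padic_int] by simp
  hence "inverse (of_nat m) = of_padic_int v"
    by (rule inverse_unique)
  thus ?thesis by auto
qed

text \<open>For \<open>w = u + v t\<close> with \<open>u\<close>, \<open>v\<close> linear in \<open>s\<close>, separating the even and odd parts in \<open>s\<close> of
  \<open>(w - u)\<^sup>2 - v\<^sup>2 B = 0\<close> gives \<open>E + F s = 0\<close>, hence the monic quartic equation \<open>E\<^sup>2 - A F\<^sup>2 = 0\<close>.\<close>

lemma biquadratic_ring_integral:
  fixes s t :: "'p::prime_card padic alg_closure"
  assumes s: "s ^ 2 = of_padic_int A" and t: "t ^ 2 = of_padic_int B"
  shows "biquadratic_ring s t \<subseteq> integral_padics"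
proof
  fix w assume "w \<in> biquadratic_ring s t"
  then obtain \<alpha> \<beta> \<gamma> \<delta> where
    w: "w = of_padic_int \<alpha> + of_padic_int \<beta> * s + (of_padic_int \<gamma> + of_padic_int \<delta> * s) * t"
    unfolding biquadratic_ring_def by blast
  define e1 e0 f1 f0 where "e1 = - 2 * \<alpha>" "e0 = \<alpha> ^ 2 + \<beta> ^ 2 * A - B * (\<gamma> ^ 2 + \<delta> ^ 2 * A)"
    "f1 = - 2 * \<beta>" "f0 = 2 * \<alpha> * \<beta> - 2 * \<gamma> * \<delta> * B"
  note defs = this
  \<comment> \<open>The expansion of E^2 - A F^2 in w, where E = w^2 + \<open>e1\<close> w +
    \<open>e0\<close> and F = \<open>f1\<close> w + \<open>f0\<close>.\<close>
  define q where "q = [:e0 ^ 2 - A * f0 ^ 2, 2 * e0 * e1 - A * (2 * f0 * f1),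
    e1 ^ 2 + 2 * e0 - A * f1 ^ 2, 2 * e1, 1:]"
  have "poly (map_poly of_padic_int q) w =
      (w ^ 2 + of_padic_int e1 * w + of_padic_int e0) ^ 2
      - of_padic_int A * (of_padic_int f1 * w + of_padic_int f0) ^ 2"
    unfolding q_def by (simp add: map_poly_pCons algebra_simps power2_eq_square)
  also have "w ^ 2 + of_padic_int e1 * w + of_padic_int e0 = - ((of_padic_int f1 * w + of_padic_int f0) * s)"
  proof -
    have "(w - (of_padic_int \<alpha> + of_padic_int \<beta> * s)) ^ 2 = (of_padic_int \<gamma> + of_padic_int \<delta> * s) ^ 2 * t ^ 2"
      by (simp add: w power_mult_distrib)
    hence "w ^ 2 - 2 * of_padic_int \<alpha> * w + of_padic_int \<alpha> ^ 2 + of_padic_int \<beta> ^ 2 * s ^ 2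
        - of_padic_int B * (of_padic_int \<gamma> ^ 2 + of_padic_int \<delta> ^ 2 * s ^ 2)
        + (- 2 * of_padic_int \<beta> * w + 2 * of_padic_int \<alpha> * of_padic_int \<beta>
            - 2 * of_padic_int \<gamma> * of_padic_int \<delta> * of_padic_int B) * s = 0"
      unfolding t by (simp add: algebra_simps power2_eq_square)
    thus ?thesis unfolding s defs by (simp add: add_eq_0_iff algebra_simps)
  qed
  also have "(- ((of_padic_int f1 * w + of_padic_int f0) * s)) ^ 2
      - of_padic_int A * (of_padic_int f1 * w + of_padic_int f0) ^ 2 = 0"
    by (simp add: power_mult_distrib s)
  finally have "poly (map_poly of_padic_int q) w = 0" .
  moreover have "lead_coeff q = 1" by (simp add: q_def)
  ultimately show "w \<in> integral_padics"
    unfolding integral_padics_def by blast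
qed


section \<open>Coefficients of the Legendre polynomial\<close>

lemma central_binomial_rec: "Suc k * ((2 * Suc k) choose Suc k) = 2 * (2 * k + 1) * ((2 * k) choose k)"
proof -
  have e: "2 * Suc k = Suc (Suc (2 * k))" and d: "Suc (2 * k) - k = Suc k" by simp_all
  have "Suc k * (Suc k * ((2 * Suc k) choose Suc k)) = (2 * Suc k) * (Suc k * (Suc (2 * k) choose k))"
    unfolding e Suc_times_binomial by (rule mult.left_commute)
  also have "Suc k * (Suc (2 * k) choose k) = (2 * k + 1) * ((2 * k) choose k)"
    using binomial_absorb_comp[of "Suc (2 * k)" k] unfolding d by simp
  finally have "Suc k * (Suc k * ((2 * Suc k) choose Suc k)) =
      Suc k * (2 * (2 * k + 1) * ((2 * k) choose k))"
    by (simp only: mult_ac)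
  thus ?thesis by (simp only: mult_cancel1) simp
qed

text \<open>The factor 4(2k+1)^2 is written as 16 k(k+1) + 4 to fit
  \<open>trinomial_product_congruence\<close> with \<open>M\<close> = 16 and \<open>\<mu>\<close> =
  4.\<close>

lemma central_binomial_sq_rec:
  "Suc k ^ 2 * ((2 * Suc k) choose Suc k) ^ 2 = (16 * (k * Suc k) + 4) * ((2 * k) choose k) ^ 2"
proof -
  have "Suc k ^ 2 * ((2 * Suc k) choose Suc k) ^ 2 = (2 * (2 * k + 1) * ((2 * k) choose k)) ^ 2"
    unfolding central_binomial_rec[symmetric] by (simp only: power_mult_distrib)
  also have "\<dots> = (16 * (k * Suc k) + 4) * ((2 * k) choose k) ^ 2"
    by (simp add: power_mult_distrib power2_eq_square algebra_simps)
  finally show ?thesis .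
qed

text \<open>For k \<le> n the quotient of the second term by the first is the product over j < k of
  1 - (p^a/(2j+1))^2. Here 2j+1 < p^a, so every factor is 1 modulo p^2. For k > n the second term is
  0 and p divides C(2k,k).\<close>

lemma legendre_coeff_cong:
  fixes p a n k :: nat
  assumes p: "prime p" and n: "p ^ a = 2 * n + 1" and k: "k < p ^ a"
  shows "int p ^ 2 dvd int ((2 * k) choose k) ^ 2 - (-16) ^ k * int ((n choose k) * ((n + k) choose k))"
proof (cases "k \<le> n")
  case False
  have "p dvd ((k + k) choose k)"
    using p k False n by (intro prime_dvd_binomial_add[of p _ a]) auto
  hence "int p dvd int ((2 * k) choose k)"
    by (simp add: mult_2)
  hence "int p ^ 2 dvd int ((2 * k) choose k) ^ 2" by (rule dvd_power_same)
  thus ?thesis using False by (simp add: binomial_eq_0)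
next
  case True
  define b c where "b k = int ((2 * k) choose k) ^ 2"
    "c k = (-16) ^ k * int ((n choose k) * ((n + k) choose k))" for k
  have b_rec: "int (Suc k) ^ 2 * b (Suc k) = 4 * (2 * int k + 1) ^ 2 * b k" for k
    using arg_cong[OF central_binomial_sq_rec[of k], of int]
    by (simp add: b_c_def power2_eq_square algebra_simps)
  have c_rec: "int (Suc k) ^ 2 * c (Suc k) = 4 * ((2 * int k + 1) ^ 2 - int (p ^ a) ^ 2) * c k" for k
  proof -
    have 1: "int (Suc k) * int (n choose Suc k) = (int n - int k) * int (n choose k)"
      by (rule binomial_absorb_lower)
    have 2: "int (Suc k) * int ((n + Suc k) choose Suc k) = (int n + int k + 1) * int ((n + k) choose k)"
      using arg_cong[OF Suc_times_binomial[of k "n + k"], of int] by (simp add: algebra_simps)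
    have "int (Suc k) ^ 2 * c (Suc k) = - 16 * (-16) ^ k * (int (Suc k) * int (n choose Suc k)) *
        (int (Suc k) * int ((n + Suc k) choose Suc k))"
      by (simp add: b_c_def power2_eq_square)
    also have "\<dots> = 4 * ((2 * int k + 1) ^ 2 - int (p ^ a) ^ 2) * c k"
      unfolding 1 2 n b_c_def by (simp add: power2_eq_square algebra_simps)
    finally show ?thesis .
  qed
  \<comment> \<open>The quotient of \<open>c k\<close> by \<open>b k\<close> is 1 modulo p^2, stated
    over the integers: \<open>m\<close> clears the denominators prime to p.\<close>
  have "\<exists>m e. coprime m (int p) \<and> m * c k = (m + int p ^ 2 * e) * b k"
    using True
  proof (induction k)
    case 0
    show ?case by (rule exI[of _ 1], rule exI[of _ 0]) (simp add: b_c_def)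
  next
    case (Suc k)
    then obtain m e where m: "coprime m (int p)" and IH: "m * c k = (m + int p ^ 2 * e) * b k"
      by auto
    have "\<not> is_unit p" using p by auto
    \<comment> \<open>Splitting off the power of p in 2k+1 gives p^a/(2k+1) = p g / h, with g =
      p^(a-v-1) integral because v < a.\<close>
    obtain v h where h: "2 * k + 1 = p ^ v * h" "\<not> p dvd h"
      by (rule multiplicity_decompose'[OF _ \<open>\<not> is_unit p\<close>, of "2 * k + 1"]) (simp, rule that)
    have "p ^ v dvd 2 * k + 1" unfolding h(1) by simp
    hence "p ^ v \<le> 2 * k + 1" by (rule dvd_imp_le) simp
    also have "\<dots> < p ^ a" using Suc.prems n by simp
    finally have "v < a" using power_less_imp_less_exp[of p v a] prime_gt_1_nat[OF p] by blast
    define g where "g = p ^ (a - Suc v)"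
    have "p ^ a = p * g * p ^ v"
      using \<open>v < a\<close> by (simp add: g_def flip: power_Suc power_add)
    hence "p ^ a * h = p * g * (2 * k + 1)"
      by (subst h(1)) simp
    hence "int (p ^ a * h) = int (p * g * (2 * k + 1))" by (rule arg_cong)
    hence gh: "int (p ^ a) * int h = int p * int g * (2 * int k + 1)"
      by (simp add: algebra_simps)
    have "int h ^ 2 * ((2 * int k + 1) ^ 2 - int (p ^ a) ^ 2) =
        int h ^ 2 * (2 * int k + 1) ^ 2 - (int (p ^ a) * int h) ^ 2"
      by (simp add: algebra_simps power_mult_distrib)
    also have "\<dots> = (int h ^ 2 - int p ^ 2 * int g ^ 2) * (2 * int k + 1) ^ 2"
      unfolding gh by (simp only: left_diff_distrib power_mult_distrib)
    finally have H: "int h ^ 2 * ((2 * int k + 1) ^ 2 - int (p ^ a) ^ 2) = \<dots>" .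
    have "int (Suc k) ^ 2 * (int h ^ 2 * m * c (Suc k)) =
        4 * (int h ^ 2 * ((2 * int k + 1) ^ 2 - int (p ^ a) ^ 2)) * (m * c k)"
      using arg_cong[OF c_rec[of k], of "\<lambda>x. int h ^ 2 * m * x"] by (simp only: mult_ac)
    also have "\<dots> = (int h ^ 2 - int p ^ 2 * int g ^ 2) * (m + int p ^ 2 * e) * (4 * (2 * int k + 1) ^ 2 * b k)"
      unfolding H IH by (simp only: mult_ac)
    also have "\<dots> = int (Suc k) ^ 2 * ((int h ^ 2 - int p ^ 2 * int g ^ 2) * (m + int p ^ 2 * e) * b (Suc k))"
      unfolding b_rec[symmetric] by (simp only: mult_ac)
    finally have "int h ^ 2 * m * c (Suc k) =
        (int h ^ 2 - int p ^ 2 * int g ^ 2) * (m + int p ^ 2 * e) * b (Suc k)"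
      by (simp del: of_nat_Suc)
    hence "int h ^ 2 * m * c (Suc k) = (int h ^ 2 * m +
        int p ^ 2 * (int h ^ 2 * e - int g ^ 2 * m - int p ^ 2 * int g ^ 2 * e)) * b (Suc k)"
      by (simp add: algebra_simps)
    moreover have "coprime (int h ^ 2 * m) (int p)"
      using m prime_imp_coprime[OF p h(2)] by (simp add: coprime_commute[of h])
    ultimately show ?case by blast
  qed
  then obtain m e where m: "coprime m (int p)" and "m * c k = (m + int p ^ 2 * e) * b k" by blast
  hence "m * (b k - c k) = int p ^ 2 * (- e * b k)" by (simp add: algebra_simps)
  hence "int p ^ 2 dvd m * (b k - c k)" by (metis dvd_triv_left)
  moreover have "coprime (int p ^ 2) m" using m by (simp add: coprime_commute)
  ultimately show ?thesis
    unfolding b_c_def by (simp only: coprime_dvd_mult_right_iff)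
qed


section \<open>Recurrences for the hypergeometric coefficients\<close>

lemma binomial_mult_fact: "n = k + l \<Longrightarrow> fact k * fact l * (n choose k) = (fact n :: nat)"
  using binomial_fact_lemma[of k n] by simp

lemma fact_rec: "m = Suc n \<Longrightarrow> fact m = m * (fact n :: nat)"
  by simp

lemma fact_2_Suc: "fact (2 * Suc k) = 2 * Suc k * (2 * k + 1) * (fact (2 * k) :: nat)"
proof -
  have "2 * Suc k = 2 * k + 2" by simp
  moreover have "fact (2 * k + 2) = (2 * k + 2) * (fact (2 * k + 1) :: nat)" "fact (2 * k + 1) = (2 * k + 1) * (fact (2 * k) :: nat)"
    by (rule fact_rec; simp)+
  ultimately show ?thesis by (simp add: algebra_simps)
qed

lemma fact_3_Suc: "fact (3 * Suc k) = Suc k * (3 * (3 * k + 2) * (3 * k + 1)) * (fact (3 * k) :: nat)"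
proof -
  have "3 * Suc k = 3 * k + 3" by simp
  moreover have "fact (3 * k + 3) = (3 * k + 3) * (fact (3 * k + 2) :: nat)" "fact (3 * k + 2) = (3 * k + 2) * (fact (3 * k + 1) :: nat)" "fact (3 * k + 1) = (3 * k + 1) * (fact (3 * k) :: nat)"
    by (rule fact_rec; simp)+
  ultimately show ?thesis by (simp add: algebra_simps)
qed

text \<open>The leading factor 2(k+1)(2k+1) is kept apart because it cancels against
  \<open>fact_2_Suc\<close> in \<open>binomial_4k_rec\<close>. The grouping in
  \<open>fact_6_Suc\<close> serves the same end.\<close>

lemma fact_4_Suc: "fact (4 * Suc k) = 2 * Suc k * (2 * k + 1) * (4 * (4 * k + 3) * (4 * k + 1)) * (fact (4 * k) :: nat)"
proof -
  have "4 * Suc k = 4 * k + 4" by simp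
  moreover have "fact (4 * k + 4) = (4 * k + 4) * (fact (4 * k + 3) :: nat)" "fact (4 * k + 3) = (4 * k + 3) * (fact (4 * k + 2) :: nat)" "fact (4 * k + 2) = (4 * k + 2) * (fact (4 * k + 1) :: nat)" "fact (4 * k + 1) = (4 * k + 1) * (fact (4 * k) :: nat)"
    by (rule fact_rec; simp)+
  ultimately show ?thesis by (simp only:) (simp add: algebra_simps)
qed

lemma fact_6_Suc: "fact (6 * Suc k) = 3 * 2 * Suc k * (3 * k + 2) * (3 * k + 1) * (2 * k + 1) * (12 * (6 * k + 5) * (6 * k + 1)) * (fact (6 * k) :: nat)"
proof -
  have "6 * Suc k = 6 * k + 6" by simp
  moreover have "fact (6 * k + 6) = (6 * k + 6) * (fact (6 * k + 5) :: nat)" "fact (6 * k + 5) = (6 * k + 5) * (fact (6 * k + 4) :: nat)" "fact (6 * k + 4) = (6 * k + 4) * (fact (6 * k + 3) :: nat)" "fact (6 * k + 3) = (6 * k + 3) * (fact (6 * k + 2) :: nat)" "fact (6 * k + 2) = (6 * k + 2) * (fact (6 * k + 1) :: nat)" "fact (6 * k + 1) = (6 * k + 1) * (fact (6 * k) :: nat)"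
    by (rule fact_rec; simp)+
  ultimately show ?thesis by (simp only:) (simp add: algebra_simps)
qed

text \<open>Here w k = (4k)!/((2k)! k!^2), so factorials give the ratio. Divided by 64^k it is
  (1/4)_k (3/4)_k / k!^2 in rising factorials. The next two families have parameters 1/3, 2/3 after
  division by 27^k and 1/6, 5/6 after division by 432^k.\<close>

lemma binomial_4k_rec:
  defines "w \<equiv> \<lambda>k. ((4 * k) choose (2 * k)) * ((2 * k) choose k)"
  shows "Suc k ^ 2 * w (Suc k) = (64 * (k * Suc k) + 12) * w k"
proof -
  have w: "fact (2 * k) * fact k * fact k * w k = (fact (4 * k) :: nat)" for k
  proof -
    have "fact (2 * k) * fact k * fact k * w k =
        fact (2 * k) * (fact k * fact k * ((2 * k) choose k)) * ((4 * k) choose (2 * k))"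
      by (simp only: w_def mult_ac)
    also have "\<dots> = fact (2 * k) * fact (2 * k) * ((4 * k) choose (2 * k))"
      by (subst binomial_mult_fact) simp_all
    also have "\<dots> = fact (4 * k)"
      by (rule binomial_mult_fact) simp
    finally show ?thesis .
  qed
  have c: "64 * (k * Suc k) + 12 = 4 * (4 * k + 3) * (4 * k + 1)"
    by (simp add: algebra_simps)
  have "2 * Suc k * (2 * k + 1) * (fact (2 * k) * fact k * fact k) * (Suc k ^ 2 * w (Suc k)) = fact (2 * Suc k) * fact (Suc k) * fact (Suc k) * w (Suc k)"
    by (simp only: fact_2_Suc fact_3_Suc fact_Suc of_nat_id power2_eq_square) (simp only: mult_ac)
  also have "\<dots> = fact (4 * Suc k)" by (rule w)
  also have "\<dots> = 2 * Suc k * (2 * k + 1) * (fact (2 * k) * fact k * fact k) * ((64 * (k * Suc k) + 12) * w k)"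
    unfolding fact_4_Suc w[of k, symmetric] c by (simp only: mult_ac)
  finally have eq: "2 * Suc k * (2 * k + 1) * (fact (2 * k) * fact k * fact k) * (Suc k ^ 2 * w (Suc k)) = \<dots>" .
  show ?thesis
    by (rule mult_left_cancel[THEN iffD1, OF _ eq]) simp
qed

lemma binomial_3k_rec:
  defines "w \<equiv> \<lambda>k. ((2 * k) choose k) * ((3 * k) choose k)"
  shows "Suc k ^ 2 * w (Suc k) = (27 * (k * Suc k) + 6) * w k"
proof -
  have w: "fact k * fact k * fact k * w k = (fact (3 * k) :: nat)" for k
  proof -
    have "fact k * fact k * fact k * w k =
        fact k * (fact k * fact k * ((2 * k) choose k)) * ((3 * k) choose k)"
      by (simp only: w_def mult_ac)
    also have "\<dots> = fact k * fact (2 * k) * ((3 * k) choose k)"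
      by (subst binomial_mult_fact) simp_all
    also have "\<dots> = fact (3 * k)"
      by (rule binomial_mult_fact) simp
    finally show ?thesis .
  qed
  have c: "27 * (k * Suc k) + 6 = 3 * (3 * k + 2) * (3 * k + 1)"
    by (simp add: algebra_simps)
  have "Suc k * (fact k * fact k * fact k) * (Suc k ^ 2 * w (Suc k)) = fact (Suc k) * fact (Suc k) * fact (Suc k) * w (Suc k)"
    by (simp only: fact_2_Suc fact_3_Suc fact_Suc of_nat_id power2_eq_square) (simp only: mult_ac)
  also have "\<dots> = fact (3 * Suc k)" by (rule w)
  also have "\<dots> = Suc k * (fact k * fact k * fact k) * ((27 * (k * Suc k) + 6) * w k)"
    unfolding fact_3_Suc w[of k, symmetric] c by (simp only: mult_ac)
  finally have eq: "Suc k * (fact k * fact k * fact k) * (Suc k ^ 2 * w (Suc k)) = \<dots>" .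
  show ?thesis
    by (rule mult_left_cancel[THEN iffD1, OF _ eq]) simp
qed

lemma binomial_6k_rec:
  defines "w \<equiv> \<lambda>k. ((6 * k) choose (3 * k)) * ((3 * k) choose k)"
  shows "Suc k ^ 2 * w (Suc k) = (432 * (k * Suc k) + 60) * w k"
proof -
  have w: "fact (3 * k) * fact (2 * k) * fact k * w k = (fact (6 * k) :: nat)" for k
  proof -
    have "fact (3 * k) * fact (2 * k) * fact k * w k =
        fact (3 * k) * (fact k * fact (2 * k) * ((3 * k) choose k)) * ((6 * k) choose (3 * k))"
      by (simp only: w_def mult_ac)
    also have "\<dots> = fact (3 * k) * fact (3 * k) * ((6 * k) choose (3 * k))"
      by (subst binomial_mult_fact) simp_all
    also have "\<dots> = fact (6 * k)"
      by (rule binomial_mult_fact) simp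
    finally show ?thesis .
  qed
  have c: "432 * (k * Suc k) + 60 = 12 * (6 * k + 5) * (6 * k + 1)"
    by (simp add: algebra_simps)
  have "3 * 2 * Suc k * (3 * k + 2) * (3 * k + 1) * (2 * k + 1) * (fact (3 * k) * fact (2 * k) * fact k) * (Suc k ^ 2 * w (Suc k)) = fact (3 * Suc k) * fact (2 * Suc k) * fact (Suc k) * w (Suc k)"
    by (simp only: fact_2_Suc fact_3_Suc fact_Suc of_nat_id power2_eq_square) (simp only: mult_ac)
  also have "\<dots> = fact (6 * Suc k)" by (rule w)
  also have "\<dots> = 3 * 2 * Suc k * (3 * k + 2) * (3 * k + 1) * (2 * k + 1) * (fact (3 * k) * fact (2 * k) * fact k) * ((432 * (k * Suc k) + 60) * w k)"
    unfolding fact_6_Suc w[of k, symmetric] c by (simp only: mult_ac)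
  finally have eq: "3 * 2 * Suc k * (3 * k + 2) * (3 * k + 1) * (2 * k + 1) * (fact (3 * k) * fact (2 * k) * fact k) * (Suc k ^ 2 * w (Suc k)) = \<dots>" .
  show ?thesis
    by (rule mult_left_cancel[THEN iffD1, OF _ eq]) simp
qed


section \<open>The congruences\<close>

lemma padic_congI:
  assumes "S \<subseteq> integral_padics" "\<exists>w\<in>S. u - v = of_nat m * w"
  shows "padic_cong m u v"
  using assms unfolding padic_cong_def by blast

text \<open>Scaling by \<open>- \<xi>\<close> makes the left side the central coefficient of the
  k-th power of t^2 - b\<xi> t + c\<xi>^2, which the hypotheses factor as (t + g)(t + h).\<close>

lemma of_int_trinomial_factored:
  fixes g h \<xi> :: "'a::field"
  assumes "g + h = - (of_int b * \<xi>)" "g * h = of_int c * \<xi> ^ 2"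
  shows "of_int (trinomial k b c) * (- \<xi>) ^ k = (\<Sum>j\<le>k. of_nat (k choose j) ^ 2 * g ^ j * h ^ (k - j))"
proof -
  have "of_int (trinomial k b c) * (- \<xi>) ^ k = coeff ([:of_int c * (- \<xi>) ^ 2, of_int b * - \<xi>, 1:] ^ k) k"
    unfolding of_int_trinomial coeff_trinomial_scale by (rule mult.commute)
  also have "[:of_int c * (- \<xi>) ^ 2, of_int b * - \<xi>, 1:] = [:g * h, g + h, 1:]"
    using assms by simp
  finally show ?thesis by (simp only: coeff_trinomial_factored)
qed

text \<open>Inserting sD^2 into 4yz = (1-sD)^2 - d\<xi>^2 gives 2yz = y + z + b\<xi>, hence the sum.
  The difference y(1-z) - z(1-y) is sd \<xi>, and the product follows from 4gh = (g+h)^2 - (g-h)^2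
  with b^2 - d = 4c.\<close>

lemma trinomial_substitution:
  fixes y z sd sD \<xi> :: "'a::field_char_0"
  assumes "d = b ^ 2 - 4 * c" and "sd ^ 2 = of_int d" "sD ^ 2 = 1 + 2 * of_int b * \<xi> + of_int d * \<xi> ^ 2"
  defines "y \<equiv> (1 - sD + sd * \<xi>) / 2" and "z \<equiv> (1 - sD - sd * \<xi>) / 2"
  shows "y * (1 - z) + z * (1 - y) = - (of_int b * \<xi>)" (is ?sum)
    and "(y * (1 - z)) * (z * (1 - y)) = of_int c * \<xi> ^ 2" (is ?prod)
proof -
  have yz: "4 * (y * z) = (1 - sD) ^ 2 - sd ^ 2 * \<xi> ^ 2"
    unfolding y_def z_def by (simp add: field_simps power2_eq_square)
  hence "2 * (2 * (y * z)) = 2 * (1 - sD + of_int b * \<xi>)"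
    unfolding assms(2) by (simp add: power2_diff assms(3) algebra_simps)
  hence yz': "2 * (y * z) = 1 - sD + of_int b * \<xi>"
    by (simp only: mult_cancel_left) simp
  have add: "y + z = 1 - sD" unfolding y_def z_def by (simp add: field_simps)
  show sum: ?sum
  proof -
    have "y * (1 - z) + z * (1 - y) = (y + z) - 2 * (y * z)" by (simp add: algebra_simps)
    thus ?thesis unfolding add yz' by simp
  qed
  have diff: "y * (1 - z) - z * (1 - y) = sd * \<xi>"
    unfolding y_def z_def by (simp add: field_simps)
  have "4 * ((y * (1 - z)) * (z * (1 - y))) =
      (y * (1 - z) + z * (1 - y)) ^ 2 - (y * (1 - z) - z * (1 - y)) ^ 2"
    by (simp add: power2_eq_square algebra_simps)
  also have "\<dots> = of_int b ^ 2 * \<xi> ^ 2 - of_int d * \<xi> ^ 2"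
    unfolding sum diff by (simp add: power_mult_distrib assms(2))
  also have "\<dots> = 4 * (of_int c * \<xi> ^ 2)"
    unfolding assms(1) by (simp add: algebra_simps)
  finally show ?prod by (simp only: mult_cancel_left) simp
qed

text \<open>The common form of the four families: u_k = w_k / M^k satisfies the linearisation
  recurrence with constant - \<open>\<mu>\<close> / M. The sign in (-M)^k passes to
  \<open>\<xi>\<close>, and the extra 2^k in (2M)^k to the halves in y and z.\<close>

lemma trinomial_product_congruence:
  fixes p a M \<mu> :: nat and w :: "nat \<Rightarrow> nat" and sd sD \<xi> :: "'a::field_char_0"
  assumes S: "unital_subring S" and inv: "inverse (of_nat (2 * M)) \<in> S" and mem: "sd \<in> S" "sD \<in> S" "\<xi> \<in> S"
    and "prime p" and M: "M > 0"
    and w0: "w 0 = 1" and w: "\<And>k. Suc k ^ 2 * w (Suc k) = (M * (k * Suc k) + \<mu>) * w k"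
    and eqs: "d = b ^ 2 - 4 * c" "sd ^ 2 = of_int d" "sD ^ 2 = 1 + 2 * of_int b * \<xi> + of_int d * \<xi> ^ 2"
  shows "\<exists>e\<in>S. (\<Sum>k=0..p^a-1. of_nat (w k) / (- of_nat M) ^ k * of_int (trinomial k b c) * \<xi> ^ k)
      - (\<Sum>k=0..p^a-1. of_nat (w k) / of_nat (2 * M) ^ k * (1 - sD + sd * \<xi>) ^ k)
        * (\<Sum>k=0..p^a-1. of_nat (w k) / of_nat (2 * M) ^ k * (1 - sD - sd * \<xi>) ^ k) = of_nat (p ^ 2) * e"
proof -
  interpret unital_subring S by fact
  define y z where "y = (1 - sD + sd * \<xi>) / 2" and "z = (1 - sD - sd * \<xi>) / 2"
  define u :: "nat \<Rightarrow> 'a" where "u k = of_nat (w k) / of_nat M ^ k" for k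
  have M0: "(of_nat M :: 'a) \<noteq> 0" using M by simp
  \<comment> \<open>The single inverse of 2M yields those of M and of 2.\<close>
  have "of_nat 2 * inverse (of_nat (2 * M)) \<in> S" "of_nat M * inverse (of_nat (2 * M)) \<in> S"
    by (intro mult_mem inv of_nat_mem)+
  hence Minv: "inverse (of_nat M) \<in> S" and half: "inverse 2 \<in> S"
    using M0 by (simp_all add: field_simps)
  have "u k = of_nat (w k) * inverse (of_nat M) ^ k" for k
    by (simp add: u_def divide_inverse power_inverse)
  hence u_mem: "u k \<in> S" for k
    using Minv by (simp only: mult_mem power_mem of_nat_mem)
  have "y = (1 - sD + sd * \<xi>) * inverse 2" "z = (1 - sD - sd * \<xi>) * inverse 2"
    by (simp_all only: y_def z_def divide_inverse)
  hence yz: "y \<in> S" "z \<in> S"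
    by (simp_all only: mult_mem add_mem diff_mem one_mem mem half)
  have rec: "of_nat (Suc k) ^ 2 * u (Suc k) = (of_nat k * of_nat (Suc k) - (- of_nat \<mu> / of_nat M)) * u k" for k
  proof -
    have "of_nat (Suc k) ^ 2 * u (Suc k) = of_nat (Suc k ^ 2 * w (Suc k)) / of_nat M ^ Suc k"
      by (simp add: u_def)
    also have "\<dots> = of_nat ((M * (k * Suc k) + \<mu>)) * of_nat (w k) / of_nat M ^ Suc k"
      by (simp only: w of_nat_mult)
    also have "\<dots> = (of_nat ((M * (k * Suc k) + \<mu>)) / of_nat M) * u k"
      by (simp add: u_def)
    also have "of_nat ((M * (k * Suc k) + \<mu>)) / of_nat M =
        (of_nat k * of_nat (Suc k) - (- of_nat \<mu> / of_nat M) :: 'a)"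
      using M0 by (simp add: field_simps)
    finally show ?thesis .
  qed
  have u0: "u 0 = 1" by (simp add: u_def w0)
  have "{0..n-1} = {..<n}" if "n > 0" for n :: nat
    using that by auto
  from this[of "p ^ a"] have rng: "{0..p^a-1} = {..<p^a}"
    using \<open>prime p\<close> by (simp add: prime_gt_0_nat)
  note sub = trinomial_substitution[OF eqs, folded y_def z_def]
  have "of_nat (w k) / (- of_nat M) ^ k * of_int (trinomial k b c) * \<xi> ^ k =
      u k * (\<Sum>j\<le>k. of_nat (k choose j) ^ 2 * (y * (1 - z)) ^ j * (z * (1 - y)) ^ (k - j))" for k
    unfolding of_int_trinomial_factored[OF sub, symmetric] u_def
    by (cases "even k") (simp_all add: mult_ac)
  moreover have "of_nat (w k) / of_nat (2 * M) ^ k * (1 - sD + sd * \<xi>) ^ k = u k * y ^ k"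
      "of_nat (w k) / of_nat (2 * M) ^ k * (1 - sD - sd * \<xi>) ^ k = u k * z ^ k" for k
    by (simp_all add: u_def y_def z_def power_divide power_mult_distrib)
  ultimately show ?thesis
    unfolding rng using truncated_product[OF u0 rec u_mem yz \<open>prime p\<close>, of a] by simp
qed

section \<open>Comparison with Legendre polynomials\<close>

text \<open>In z = (1-t)/2 both sides are polynomials, and \<open>legendre_coeff_cong\<close>
  compares their coefficients after multiplication by 16^k. As 16 is invertible in S, dividing back
  keeps the quotient in S.\<close>

lemma legendre_congruence:
  fixes p a :: nat and sd sD \<xi> t :: "'a::field_char_0"
  assumes S: "unital_subring S" and inv: "inverse (of_nat 2) \<in> S" and mem: "t \<in> S"
    and "prime p" "odd p"
  shows "\<exists>e\<in>S. (\<Sum>k=0..p^a-1. of_nat (((2 * k) choose k) ^ 2) / 32 ^ k * (1 - t) ^ k)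
      - legendre_poly ((p ^ a - 1) div 2) t = of_nat (p ^ 2) * e"
proof -
  interpret unital_subring S by fact
  define n where "n = (p ^ a - 1) div 2"
  define z where "z = (1 - t) / 2"
  have n: "p ^ a = 2 * n + 1" using \<open>odd p\<close> by (auto simp: n_def elim: oddE)
  have rng: "{0..p^a-1} = {..<p^a}" using n by auto
  have "z = (1 - t) * inverse (of_nat 2)"
    by (simp only: z_def divide_inverse of_nat_numeral)
  hence z: "z \<in> S" by (simp only: mult_mem diff_mem one_mem mem inv)
  have "inverse (of_nat 2) ^ 4 \<in> S" using inv by (rule power_mem)
  hence inv16: "inverse 16 \<in> S" by (simp add: power_divide)
  define E where "E k = (int ((2 * k) choose k) ^ 2 - (-16) ^ k * int ((n choose k) * ((n + k) choose k))) div int p ^ 2" for k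
  have "legendre_poly n t = (\<Sum>k=0..n. of_nat ((n choose k) * ((n + k) choose k)) * (- z) ^ k)"
    unfolding legendre_poly_def z_def by (simp add: minus_divide_left)
  also have "\<dots> = (\<Sum>k<p^a. of_nat ((n choose k) * ((n + k) choose k)) * (- z) ^ k)"
    using n by (intro sum.mono_neutral_left) auto
  finally have "(\<Sum>k=0..p^a-1. of_nat (((2 * k) choose k) ^ 2) / 32 ^ k * (1 - t) ^ k) - legendre_poly n t =
      (\<Sum>k<p^a. of_nat (((2 * k) choose k) ^ 2) / 32 ^ k * (1 - t) ^ k
        - of_nat ((n choose k) * ((n + k) choose k)) * (- z) ^ k)"
    by (simp only: rng sum_subtractf)
  also have "\<dots> = (\<Sum>k<p^a. of_nat (p ^ 2) * (of_int (E k) * (inverse 16 * z) ^ k))"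
  proof (intro sum.cong refl)
    fix k assume "k \<in> {..<p^a}"
    hence Ek: "int p ^ 2 * E k = int ((2 * k) choose k) ^ 2 - (-16) ^ k * int ((n choose k) * ((n + k) choose k))"
      unfolding E_def using legendre_coeff_cong[OF \<open>prime p\<close> n] by simp
    have 1: "(-16) ^ k * (inverse 16 * z) ^ k = (- z) ^ k"
      by (simp flip: power_mult_distrib)
    have 2: "(inverse 16 * z) ^ k = (1 - t) ^ k / 32 ^ k"
      by (simp add: z_def flip: power_divide)
    from arg_cong[OF Ek, of "of_int :: int \<Rightarrow> 'a"]
    have E: "of_nat (p ^ 2) * of_int (E k) = of_nat (((2 * k) choose k) ^ 2)
        - (-16) ^ k * (of_nat ((n choose k) * ((n + k) choose k)) :: 'a)" by simp
    have "of_nat (p ^ 2) * (of_int (E k) * (inverse 16 * z) ^ k) =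
        (of_nat (p ^ 2) * of_int (E k)) * (inverse 16 * z) ^ k" by (rule mult.assoc[symmetric])
    also have "\<dots> = of_nat (((2 * k) choose k) ^ 2) * (inverse 16 * z) ^ k
        - of_nat ((n choose k) * ((n + k) choose k)) * (((-16) ^ k) * (inverse 16 * z) ^ k)"
      unfolding E by (simp add: algebra_simps)
    also have "\<dots> = of_nat (((2 * k) choose k) ^ 2) / 32 ^ k * (1 - t) ^ k
        - of_nat ((n choose k) * ((n + k) choose k)) * (- z) ^ k"
      unfolding 1 unfolding 2 by simp
    finally show "of_nat (((2 * k) choose k) ^ 2) / 32 ^ k * (1 - t) ^ k
        - of_nat ((n choose k) * ((n + k) choose k)) * (- z) ^ k =
        of_nat (p ^ 2) * (of_int (E k) * (inverse 16 * z) ^ k)" ..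
  qed
  also have "\<dots> = of_nat (p ^ 2) * (\<Sum>k<p^a. of_int (E k) * (inverse 16 * z) ^ k)"
    by (simp only: sum_distrib_left)
  finally have "(\<Sum>k=0..p^a-1. of_nat (((2 * k) choose k) ^ 2) / 32 ^ k * (1 - t) ^ k)
      - legendre_poly ((p ^ a - 1) div 2) t = \<dots>" by (simp only: n_def)
  moreover have "(\<Sum>k<p^a. of_int (E k) * (inverse 16 * z) ^ k) \<in> S"
    using inv16 z by blast
  ultimately show ?thesis by blast
qed

text \<open>The product splits into terms built from u', v' and the two differences, each term
  containing a difference and hence a factor m.\<close>

lemma (in unital_subring) mult_cong:
  assumes "\<exists>e\<in>S. u - u' = of_nat m * e" "\<exists>e\<in>S. v - v' = of_nat m * e" "u' \<in> S" "v' \<in> S"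
  shows "\<exists>e\<in>S. u * v - u' * v' = of_nat m * e"
proof -
  from assms obtain e e' where e: "e \<in> S" "u - u' = of_nat m * e" "e' \<in> S" "v - v' = of_nat m * e'" by blast
  have "u * v - u' * v' = (u - u') * v' + u' * (v - v') + (u - u') * (v - v')"
    by (simp add: algebra_simps)
  also have "\<dots> = of_nat m * (e * v' + u' * e' + of_nat m * (e * e'))"
    unfolding e by (simp add: algebra_simps)
  finally show ?thesis using e assms(3,4) by blast
qed

lemma (in unital_subring) legendre_poly_mem:
  assumes "inverse (of_nat 2) \<in> S" "t \<in> S"
  shows "legendre_poly n t \<in> S"
proof -
  have "(t - 1) / 2 = (t - 1) * inverse (of_nat 2)" by (simp only: divide_inverse of_nat_numeral)
  also have "\<dots> \<in> S" by (intro mult_mem diff_mem one_mem assms)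
  finally show ?thesis
    unfolding legendre_poly_def by (intro sum_mem mult_mem power_mem of_nat_mem)
qed

theorem theorem3p3:
  fixes p a :: nat
    and b c d :: int
    and x D :: "'p::prime_card padic_int"
    and sd sD \<xi> :: "'p padic alg_closure"
  assumes "p = CARD('p)" and "prime p" and "odd p"
    and "a > 0"
    and "d = b ^ 2 - 4 * c"
    and "D = 1 + 2 * of_int b * x + of_int d * x ^ 2"
    and "sd ^ 2 = of_int d"
    and "sD ^ 2 = of_padic_int D"
    and "\<xi> = of_padic_int x"
  shows
    "padic_cong (p^2)
       (\<Sum>k=0..p^a-1. of_nat (((2*k) choose k)^2) / (-16) ^ k * of_int (trinomial k b c) * \<xi> ^ k)
       ((\<Sum>k=0..p^a-1. of_nat (((2*k) choose k)^2) / 32 ^ k * (1 - sD + sd * \<xi>) ^ k)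
        * (\<Sum>k=0..p^a-1. of_nat (((2*k) choose k)^2) / 32 ^ k * (1 - sD - sd * \<xi>) ^ k)) \<and>
     padic_cong (p^2)
       ((\<Sum>k=0..p^a-1. of_nat (((2*k) choose k)^2) / 32 ^ k * (1 - sD + sd * \<xi>) ^ k)
        * (\<Sum>k=0..p^a-1. of_nat (((2*k) choose k)^2) / 32 ^ k * (1 - sD - sd * \<xi>) ^ k))
       (legendre_poly ((p^a-1) div 2) (sD + sd * \<xi>) * legendre_poly ((p^a-1) div 2) (sD - sd * \<xi>)) \<and>
     padic_cong (p^2)
       (\<Sum>k=0..p^a-1. of_nat (((4*k) choose (2*k)) * ((2*k) choose k)) / (-64) ^ k * of_int (trinomial k b c) * \<xi> ^ k)
       ((\<Sum>k=0..p^a-1. of_nat (((4*k) choose (2*k)) * ((2*k) choose k)) / 128 ^ k * (1 - sD + sd * \<xi>) ^ k)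
        * (\<Sum>k=0..p^a-1. of_nat (((4*k) choose (2*k)) * ((2*k) choose k)) / 128 ^ k * (1 - sD - sd * \<xi>) ^ k)) \<and>
     (p > 3 \<longrightarrow> padic_cong (p^2)
       (\<Sum>k=0..p^a-1. of_nat (((2*k) choose k) * ((3*k) choose k)) / (-27) ^ k * of_int (trinomial k b c) * \<xi> ^ k)
       ((\<Sum>k=0..p^a-1. of_nat (((2*k) choose k) * ((3*k) choose k)) / 54 ^ k * (1 - sD + sd * \<xi>) ^ k)
        * (\<Sum>k=0..p^a-1. of_nat (((2*k) choose k) * ((3*k) choose k)) / 54 ^ k * (1 - sD - sd * \<xi>) ^ k))) \<and>
     (p > 3 \<longrightarrow> padic_cong (p^2)
       (\<Sum>k=0..p^a-1. of_nat (((6*k) choose (3*k)) * ((3*k) choose k)) / (-432) ^ k * of_int (trinomial k b c) * \<xi> ^ k)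
       ((\<Sum>k=0..p^a-1. of_nat (((6*k) choose (3*k)) * ((3*k) choose k)) / 864 ^ k * (1 - sD + sd * \<xi>) ^ k)
        * (\<Sum>k=0..p^a-1. of_nat (((6*k) choose (3*k)) * ((3*k) choose k)) / 864 ^ k * (1 - sD - sd * \<xi>) ^ k)))"
proof -
  let ?S = "biquadratic_ring sD sd"
  have sd: "sd ^ 2 = of_padic_int (of_int d)" using assms by simp
  have sD: "sD ^ 2 = 1 + 2 * of_int b * \<xi> + of_int d * \<xi> ^ 2" using assms by simp
  have S: "unital_subring ?S" and int: "?S \<subseteq> integral_padics"
    using unital_subring_biquadratic_ring[OF assms(8) sd] biquadratic_ring_integral[OF assms(8) sd] .
  interpret unital_subring ?S by (rule S)
  have mem: "sd \<in> ?S" "sD \<in> ?S" "\<xi> \<in> ?S" using assms(9) by auto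
  have inv: "inverse (of_nat m) \<in> ?S" if "coprime m p" for m
    using that unfolding \<open>p = CARD('p)\<close> by (rule inverse_in_biquadratic_ring)
  \<comment> \<open>\<open>K\<close> and \<open>L\<close> are separate from \<open>M\<close> so that
    numerals such as -16 and 32 can be matched first and identified with -M and 2M
    afterwards.\<close>
  have prod: "padic_cong (p^2)
      (\<Sum>k=0..p^a-1. of_nat (w k) / K ^ k * of_int (trinomial k b c) * \<xi> ^ k)
      ((\<Sum>k=0..p^a-1. of_nat (w k) / L ^ k * (1 - sD + sd * \<xi>) ^ k)
        * (\<Sum>k=0..p^a-1. of_nat (w k) / L ^ k * (1 - sD - sd * \<xi>) ^ k))"
    if "coprime (2 * M) p" "M > 0" "K = - of_nat M" "L = of_nat (2 * M)" "w 0 = 1"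
      "\<And>k. Suc k ^ 2 * w (Suc k) = (M * (k * Suc k) + \<mu>) * w k"
    for M \<mu> w and K L :: "'p padic alg_closure"
    unfolding that(3,4)
    by (rule padic_congI[OF int trinomial_product_congruence[OF S inv[OF that(1)] mem \<open>prime p\<close> that(2,5,6) assms(5,7) sD]])
  have cop2: "coprime 2 p" using \<open>odd p\<close> by simp
  have cop3: "coprime 3 p" if "p > 3"
    using that \<open>prime p\<close> primes_coprime[of 3 p] by simp
  have legendre: "\<exists>e\<in>?S. (\<Sum>k=0..p^a-1. of_nat (((2 * k) choose k) ^ 2) / 32 ^ k * (1 - t) ^ k)
      - legendre_poly ((p ^ a - 1) div 2) t = of_nat (p ^ 2) * e" if "t \<in> ?S" for t
    by (rule legendre_congruence[OF S inv[OF cop2] that \<open>prime p\<close> \<open>odd p\<close>])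
  have t: "sD - sd * \<xi> \<in> ?S" "sD + sd * \<xi> \<in> ?S"
    by (intro add_mem diff_mem mult_mem mem)+
  \<comment> \<open>The sum with + sd \<xi> belongs to the Legendre argument sD - sd \<xi>, so the
    two Legendre factors are swapped below.\<close>
  have t': "1 - sD + sd * \<xi> = 1 - (sD - sd * \<xi>)" "1 - sD - sd * \<xi> = 1 - (sD + sd * \<xi>)"
    by simp_all
  have leg: "padic_cong (p^2)
       ((\<Sum>k=0..p^a-1. of_nat (((2*k) choose k)^2) / 32 ^ k * (1 - sD + sd * \<xi>) ^ k)
        * (\<Sum>k=0..p^a-1. of_nat (((2*k) choose k)^2) / 32 ^ k * (1 - sD - sd * \<xi>) ^ k))
       (legendre_poly ((p^a-1) div 2) (sD + sd * \<xi>) * legendre_poly ((p^a-1) div 2) (sD - sd * \<xi>))"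
    unfolding t' mult.commute[of "legendre_poly _ (sD + sd * \<xi>)"]
    by (intro padic_congI[OF int] mult_cong legendre legendre_poly_mem inv cop2 t)
  have cop: "coprime (2 * 16) p" "coprime (2 * 64) p"
      "p > 3 \<Longrightarrow> coprime (2 * 27) p" "p > 3 \<Longrightarrow> coprime (2 * 432) p"
  proof -
    \<comment> \<open>The denominators involve only the primes 2 and 3; the prime 3 occurs just in
      the two families stated for p > 3.\<close>
    have *: "(2 * 16 :: nat) = 2 ^ 5" "(2 * 64 :: nat) = 2 ^ 7"
        "(2 * 27 :: nat) = 2 * 3 ^ 3" "(2 * 432 :: nat) = 2 ^ 5 * 3 ^ 3" by simp_all
    show "coprime (2 * 16) p" "coprime (2 * 64) p"
      "p > 3 \<Longrightarrow> coprime (2 * 27) p" "p > 3 \<Longrightarrow> coprime (2 * 432) p"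
      unfolding * using cop2 cop3
      by (simp_all only: coprime_mult_left_iff coprime_power_left_iff simp_thms)
  qed
  show ?thesis
    by (intro conjI impI leg
        prod[of 16 _ _ "\<lambda>k. ((2 * k) choose k) ^ 2", OF cop(1) _ _ _ _ central_binomial_sq_rec]
        prod[of 64 _ _ "\<lambda>k. ((4 * k) choose (2 * k)) * ((2 * k) choose k)", OF cop(2) _ _ _ _ binomial_4k_rec]
        prod[of 27 _ _ "\<lambda>k. ((2 * k) choose k) * ((3 * k) choose k)", OF cop(3) _ _ _ _ binomial_3k_rec]
        prod[of 432 _ _ "\<lambda>k. ((6 * k) choose (3 * k)) * ((3 * k) choose k)", OF cop(4) _ _ _ _ binomial_6k_rec])
      simp_all
qed

end
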